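(* For $x=(x_1,x_2)$, $y=(y_1,y_2)$ in $[-1,1]^2$, let $$s=(2x_1x_2,\;x_1^2+x_2^2-1),\qquad t=(2y_1y_2,\;y_1^2+y_2^2-1).$$ Then for every $n\ge0$ the reproducing kernel $\mathcal{K}_n^{(\gamma)}(\cdot,\cdot)=K_n(\mathcal{W}_\gamma;\cdot,\cdot)$ is given by $$\mathcal{K}_n^{(\gamma)}(x,y)=K_{\lfloor\frac n2\rfloor}^{(\gamma)}(s,t)+d^\gamma_{w^{(1,1)}}(x_1^2-x_2^2)(y_1^2-y_2^2)K_{\lfloor\frac n2\rfloor-1}^{(\gamma),1,1}(s,t)$$ $$\qquad+\,d^\gamma_{w^{(0,1)}}(x_1+x_2)(y_1+y_2)K_{\lfloor\frac{n-1}2\rfloor}^{(\gamma),0,1}(s,t)+d^\gamma_{w^{(1,0)}}(x_1-x_2)(y_1-y_2)K_{\lfloor\frac{n-1}2\rfloor}^{(\gamma),1,0}(s,t),$$ where $d^\gamma_{w^{(i,j)}}=a^\gamma_{w^{(i,j)}}/a^\gamma_w$ for $i,j=0,1$ (kernels of index $-1$ being $0$).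
   Context: For a nonnegative weight function $w$ on $[-1,1]$ and $\gamma>-1$ with $0<\int_{[-1,1]^2}w(x)w(y)|x-y|^{2\gamma+1}dxdy<\infty$, let $a_w^\gamma$ be the reciprocal of this integral. Let $\Omega=\{(u,v):1+u+v>0,\;1-u+v>0,\;u^2>4v\}$, the bijective image of $\{-1<\sigma<\tau<1\}$ under $(\sigma,\tau)\mapsto(\sigma+\tau,\sigma\tau)$, and $$W_\gamma(u,v)=2a_w^\gamma w(\sigma)w(\tau)(u^2-4v)^\gamma,\quad u=\sigma+\tau,\;v=\sigma\tau,$$ and on $[-1,1]^2$ let $\mathcal{W}_\gamma(x_1,x_2)=W_\gamma(2x_1x_2,x_1^2+x_2^2-1)|x_1^2-x_2^2|$. For $i,j\in\{0,1\}$ let $w^{(i,j)}(x)=(1-x)^i(1+x)^jw(x)$ and $$W_\gamma^{(i,j)}(u,v)=\frac{a_{w^{(i,j)}}^\gamma}{a_w^\gamma}(1-u+v)^i(1+u+v)^jW_\gamma(u,v),$$ which has integral $1$ over $\Omega$. For a weight $W$ on a domain $D\subset\mathbb{R}^2$, $K_n(W;\cdot,\cdot)$ is the reproducing kernel of the space $\Pi_n^2$ of polynomials of total degree at most $n$ in $L^2(W)$, i.e. the unique function, in $\Pi_n^2$ in each argument, with $\int_DK_n(W;x,y)f(y)W(y)dy=f(x)$ for all $f\in\Pi_n^2$. We write $K_n^{(\gamma)}=K_n(W_\gamma;\cdot,\cdot)$ and $K_n^{(\gamma),i,j}=K_n(W_\gamma^{(i,j)};\cdot,\cdot)$. *)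

theory Defs
  imports "HOL-Analysis.Analysis"
begin

definition polys2 :: "nat \<Rightarrow> (real \<times> real \<Rightarrow> real) set" where
  "polys2 n = {f. \<exists>c :: nat \<Rightarrow> nat \<Rightarrow> real. \<forall>x y. f (x, y) = (\<Sum>i\<le>n. \<Sum>j\<le>n - i. c i j * x ^ i * y ^ j)}"

text \<open>The two slices of \<open>K\<close> are polynomials on the whole plane, so that \<open>K\<close> may be evaluated
  outside \<open>D\<close>; the reproducing property is required on \<open>D\<close> only.\<close>

definition is_reproducing_kernel ::
    "(real \<times> real) set \<Rightarrow> (real \<times> real \<Rightarrow> real) \<Rightarrow> nat \<Rightarrow> (real \<times> real \<Rightarrow> real \<times> real \<Rightarrow> real) \<Rightarrow> bool" where
  "is_reproducing_kernel D W n K \<longleftrightarrow>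
     (\<forall>x. (\<lambda>y. K x y) \<in> polys2 n) \<and>
     (\<forall>y. (\<lambda>x. K x y) \<in> polys2 n) \<and>
     (\<forall>f \<in> polys2 n. \<forall>x \<in> D.
        has_bochner_integral (lebesgue_on D) (\<lambda>y. K x y * f y * W y) (f x))"

text \<open>The index is an integer, since the kernel of index \<open>-1\<close> (which is \<open>0\<close>) also occurs.\<close>

definition reproducing_kernel ::
    "(real \<times> real) set \<Rightarrow> (real \<times> real \<Rightarrow> real) \<Rightarrow> int \<Rightarrow> real \<times> real \<Rightarrow> real \<times> real \<Rightarrow> real" where
  "reproducing_kernel D W m =
     (if m < 0 then (\<lambda>x y. 0) else (THE K. is_reproducing_kernel D W (nat m) K))"

definition square :: "(real \<times> real) set" where
  "square = {-1..1} \<times> {-1..1}"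

definition weight_integrand :: "(real \<Rightarrow> real) \<Rightarrow> real \<Rightarrow> real \<times> real \<Rightarrow> real" where
  "weight_integrand w \<gamma> = (\<lambda>(x, y). w x * w y * \<bar>x - y\<bar> powr (2 * \<gamma> + 1))"

definition norm_const :: "(real \<Rightarrow> real) \<Rightarrow> real \<Rightarrow> real" where
  "norm_const w \<gamma> = 1 / (LINT p:square|lebesgue. weight_integrand w \<gamma> p)"

definition triangle :: "(real \<times> real) set" where
  "triangle = {(\<sigma>, \<tau>). -1 < \<sigma> \<and> \<sigma> < \<tau> \<and> \<tau> < 1}"

definition sym_map :: "real \<times> real \<Rightarrow> real \<times> real" where
  "sym_map = (\<lambda>(\<sigma>, \<tau>). (\<sigma> + \<tau>, \<sigma> * \<tau>))"

text \<open>The domain is usually written as \<open>1 + u + v > 0\<close>, \<open>1 - u + v > 0\<close>, \<open>u\<^sup>2 > 4 * v\<close>. These three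
  inequalities alone also admit two unbounded components (both roots above \<open>1\<close> or both below
  \<open>-1\<close>); the intended domain is the component that is the image of the triangle, see
  \<open>Omega_eq\<close> below.\<close>

definition Omega :: "(real \<times> real) set" where
  "Omega = sym_map ` triangle"

lemma inj_on_sym_map: "inj_on sym_map triangle"
proof (rule inj_onI, clarify)
  fix a b c d :: real
  assume *: "(a, b) \<in> triangle" "(c, d) \<in> triangle" "sym_map (a, b) = sym_map (c, d)"
  then have s: "a + b = c + d" and p: "a * b = c * d" and l: "a < b" "c < d"
    by (auto simp: sym_map_def triangle_def)
  have "(b - a)\<^sup>2 = (a + b)\<^sup>2 - 4 * (a * b)" by (simp add: power2_eq_square algebra_simps)
  also have "\<dots> = (d - c)\<^sup>2" unfolding s p by (simp add: power2_eq_square algebra_simps)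
  finally have "b - a = d - c" using l by (simp add: power2_eq_iff_nonneg)
  with s show "a = c \<and> b = d" by auto
qed

lemma Omega_eq:
  "Omega = {(u, v). 1 + u + v > 0 \<and> 1 - u + v > 0 \<and> u\<^sup>2 > 4 * v \<and> \<bar>u\<bar> < 2}"
proof (intro equalityI subsetI)
  fix p assume "p \<in> Omega"
  then obtain a b where p: "p = (a + b, a * b)" and ab: "-1 < a" "a < b" "b < 1"
    by (auto simp: Omega_def triangle_def sym_map_def)
  have "0 < (1 + a) * (1 + b)" "0 < (1 - a) * (1 - b)" "0 < (b - a)\<^sup>2" using ab by auto
  then show "p \<in> {(u, v). 1 + u + v > 0 \<and> 1 - u + v > 0 \<and> u\<^sup>2 > 4 * v \<and> \<bar>u\<bar> < 2}"
    using ab p by (auto simp: algebra_simps power2_eq_square)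
next
  fix p assume "p \<in> {(u, v). 1 + u + v > 0 \<and> 1 - u + v > 0 \<and> u\<^sup>2 > 4 * v \<and> \<bar>u\<bar> < (2::real)}"
  then obtain u v where p: "p = (u, v)" and h: "1 + u + v > 0" "1 - u + v > 0" "u\<^sup>2 > 4 * v" "\<bar>u\<bar> < 2"
    by auto
  define r where "r = sqrt (u\<^sup>2 - 4 * v)"
  have r: "r > 0" "r\<^sup>2 = u\<^sup>2 - 4 * v" using h by (auto simp: r_def)
  have "r\<^sup>2 < (2 - u)\<^sup>2" "r\<^sup>2 < (2 + u)\<^sup>2" using h unfolding r(2) by (auto simp: power2_eq_square algebra_simps)
  then have lt: "r < 2 - u" "r < 2 + u" using h(4) by (auto intro: power2_less_imp_less)
  have "(u - r) / 2 * ((u + r) / 2) = (u\<^sup>2 - r\<^sup>2) / 4" by (simp add: power2_eq_square algebra_simps)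
  then have "p = sym_map ((u - r) / 2, (u + r) / 2)"
    using r by (simp add: p sym_map_def field_simps)
  moreover have "((u - r) / 2, (u + r) / 2) \<in> triangle" using lt r by (auto simp: triangle_def)
  ultimately show "p \<in> Omega" unfolding Omega_def by blast
qed

text \<open>\<open>W_weight\<close> is meaningful on \<open>Omega\<close> only.\<close>

definition W_weight :: "(real \<Rightarrow> real) \<Rightarrow> real \<Rightarrow> real \<times> real \<Rightarrow> real" where
  "W_weight w \<gamma> = (\<lambda>(u, v). case the_inv_into triangle sym_map (u, v) of
     (\<sigma>, \<tau>) \<Rightarrow> 2 * norm_const w \<gamma> * w \<sigma> * w \<tau> * (u\<^sup>2 - 4 * v) powr \<gamma>)"

lemma W_weight_sym_map:
  assumes "-1 < \<sigma>" "\<sigma> < \<tau>" "\<tau> < 1"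
  shows "W_weight w \<gamma> (\<sigma> + \<tau>, \<sigma> * \<tau>) =
    2 * norm_const w \<gamma> * w \<sigma> * w \<tau> * ((\<sigma> + \<tau>)\<^sup>2 - 4 * (\<sigma> * \<tau>)) powr \<gamma>"
proof -
  have "the_inv_into triangle sym_map (sym_map (\<sigma>, \<tau>)) = (\<sigma>, \<tau>)"
    using assms by (intro the_inv_into_f_f inj_on_sym_map) (auto simp: triangle_def)
  then show ?thesis by (simp add: W_weight_def sym_map_def)
qed

definition quad_map :: "real \<times> real \<Rightarrow> real \<times> real" where
  "quad_map = (\<lambda>(x1, x2). (2 * x1 * x2, x1\<^sup>2 + x2\<^sup>2 - 1))"

text \<open>Points of the square that \<open>quad_map\<close> sends outside \<open>Omega\<close> satisfy \<open>x1\<^sup>2 = x2\<^sup>2\<close>, or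
  \<open>u\<^sup>2 = 4 * v\<close> where \<open>0 powr \<gamma> = 0\<close>; so the weight below vanishes on this null set.\<close>

definition square_weight :: "(real \<Rightarrow> real) \<Rightarrow> real \<Rightarrow> real \<times> real \<Rightarrow> real" where
  "square_weight w \<gamma> = (\<lambda>(x1, x2). W_weight w \<gamma> (quad_map (x1, x2)) * \<bar>x1\<^sup>2 - x2\<^sup>2\<bar>)"

definition mod_weight :: "nat \<Rightarrow> nat \<Rightarrow> (real \<Rightarrow> real) \<Rightarrow> real \<Rightarrow> real" where
  "mod_weight i j w = (\<lambda>x. (1 - x) ^ i * (1 + x) ^ j * w x)"

definition d_const :: "nat \<Rightarrow> nat \<Rightarrow> (real \<Rightarrow> real) \<Rightarrow> real \<Rightarrow> real" where
  "d_const i j w \<gamma> = norm_const (mod_weight i j w) \<gamma> / norm_const w \<gamma>"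

definition W_mod_weight :: "nat \<Rightarrow> nat \<Rightarrow> (real \<Rightarrow> real) \<Rightarrow> real \<Rightarrow> real \<times> real \<Rightarrow> real" where
  "W_mod_weight i j w \<gamma> = (\<lambda>(u, v).
     d_const i j w \<gamma> * (1 - u + v) ^ i * (1 + u + v) ^ j * W_weight w \<gamma> (u, v))"

end

theory Submission
  imports Defs
begin

text \<open>
  Write \<open>A = x\<^sub>1 + x\<^sub>2\<close>, \<open>B = x\<^sub>1 - x\<^sub>2\<close> and \<open>(u, v)\<close> for the image of \<open>x\<close> under \<open>quad_map\<close>. Everything rests
  on the identities \<open>A\<^sup>2 = 1 + u + v\<close> and \<open>B\<^sup>2 = 1 - u + v\<close>: the map \<open>quad_map\<close> is, up to an affine change
  of coordinates, \<open>(A, B) \<mapsto> (A\<^sup>2, B\<^sup>2)\<close>. Splitting a polynomial in \<open>A, B\<close> according to the parities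
  of its exponents therefore writes every \<open>f\<close> of degree at most \<open>n\<close> as
  \<open>f\<^sub>0\<^sub>0 + A f\<^sub>0\<^sub>1 + B f\<^sub>1\<^sub>0 + A B f\<^sub>1\<^sub>1\<close>, where the \<open>f\<^sub>i\<^sub>j\<close> are polynomials in \<open>(u, v)\<close> whose degrees are at
  most the indices of the four kernels in the formula (\<open>polys2_parity_decomposable\<close>).

  The weight on the square is invariant under the sign changes of \<open>A\<close> and of \<open>B\<close>, that is, under the
  reflections in the diagonals and their product \<open>x \<mapsto> -x\<close>. Hence the terms with a factor \<open>A\<close>, \<open>B\<close> or
  \<open>A B\<close> integrate to zero (\<open>square_integral_odd\<close>). The diagonals cut the square into four congruent
  sectors; \<open>quad_map\<close> maps each of them bijectively onto \<open>Omega\<close> with Jacobian \<open>4 |x\<^sub>1\<^sup>2 - x\<^sub>2\<^sup>2|\<close>, so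
  an even term has the same integral over the square and over \<open>Omega\<close> (\<open>square_integral_even\<close>).

  In the integral of a product of two such decompositions only \<open>f\<^sub>0\<^sub>0 g\<^sub>0\<^sub>0\<close>, \<open>A\<^sup>2 f\<^sub>0\<^sub>1 g\<^sub>0\<^sub>1\<close>, \<open>B\<^sup>2 f\<^sub>1\<^sub>0 g\<^sub>1\<^sub>0\<close> and
  \<open>A\<^sup>2 B\<^sup>2 f\<^sub>1\<^sub>1 g\<^sub>1\<^sub>1\<close> survive. Since \<open>A\<^sup>2\<close> and \<open>B\<^sup>2\<close> are the factors by which the modified weights differ from
  the original one, the four components are separately reproduced by the four kernels on \<open>Omega\<close>,
  and the right-hand side of the formula is a reproducing kernel on the square
  (\<open>is_reproducing_kernel_assembled\<close>).

  For this to determine the kernels, they must exist and be unique. Both follow once each weight is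
  definite on polynomials. Passing from \<open>Omega\<close> to the triangle of the \<open>(\<sigma>, \<tau>)\<close>, the Jacobian
  \<open>|\<sigma> - \<tau>|\<close> turns all integrals into multiples of integrals of polynomials against
  \<open>w \<sigma> w \<tau> |\<sigma> - \<tau>| powr (2 \<gamma> + 1)\<close>. This function is positive on a set of positive measure,
  while the zeros of a nonzero polynomial form a null set, so a nonnegative polynomial with zero
  integral vanishes (\<open>Omega_positive\<close>). Definiteness on the square reduces to this through the
  decomposition: the integral of \<open>f\<^sup>2\<close> over the square is that of
  \<open>f\<^sub>0\<^sub>0\<^sup>2 + A\<^sup>2 f\<^sub>0\<^sub>1\<^sup>2 + B\<^sup>2 f\<^sub>1\<^sub>0\<^sup>2 + A\<^sup>2 B\<^sup>2 f\<^sub>1\<^sub>1\<^sup>2\<close> over \<open>Omega\<close>.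
\<close>

section \<open>Polynomials in two variables\<close>

lemma polys2I:
  assumes "\<And>x y. f (x, y) = (\<Sum>i\<le>n. \<Sum>j\<le>n - i. c i j * x ^ i * y ^ j)"
  shows "f \<in> polys2 n"
  using assms unfolding polys2_def by blast

lemma polys2_monom:
  assumes "i + j \<le> n"
  shows "(\<lambda>p. fst p ^ i * snd p ^ j) \<in> polys2 n"
proof (rule polys2I)
  fix x y :: real
  have "(\<Sum>j'\<le>n - i'. (if i' = i then if j' = j then 1 else 0 else 0) * x ^ i' * y ^ j')
     = (if i' = i then (\<Sum>j'\<le>n - i. if j' = j then x ^ i * y ^ j else 0) else 0)" for i'
    by (cases "i' = i") (simp_all add: mult_delta_left)
  then have "(\<Sum>i'\<le>n. \<Sum>j'\<le>n - i'. (if i' = i then if j' = j then 1 else 0 else 0) * x ^ i' * y ^ j')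
     = (\<Sum>i'\<le>n. if i' = i then (\<Sum>j'\<le>n - i. if j' = j then x ^ i * y ^ j else 0) else 0)"
    by simp
  also have "\<dots> = x ^ i * y ^ j" using assms by simp
  finally show "fst (x, y) ^ i * snd (x, y) ^ j =
     (\<Sum>i'\<le>n. \<Sum>j'\<le>n - i'. (if i' = i then if j' = j then 1 else 0 else 0) * x ^ i' * y ^ j')" by simp
qed

lemma polys2_add:
  assumes "f \<in> polys2 n" "g \<in> polys2 n"
  shows "(\<lambda>p. f p + g p) \<in> polys2 n"
proof -
  obtain c d where "\<And>x y. f (x, y) = (\<Sum>i\<le>n. \<Sum>j\<le>n - i. c i j * x ^ i * y ^ j)"
     "\<And>x y. g (x, y) = (\<Sum>i\<le>n. \<Sum>j\<le>n - i. d i j * x ^ i * y ^ j)"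
    using assms unfolding polys2_def by blast
  then show ?thesis
    by (intro polys2I[where c = "\<lambda>i j. c i j + d i j"]) (simp add: sum.distrib algebra_simps)
qed

lemma polys2_cmult:
  assumes "f \<in> polys2 n"
  shows "(\<lambda>p. c * f p) \<in> polys2 n"
proof -
  obtain d where "\<And>x y. f (x, y) = (\<Sum>i\<le>n. \<Sum>j\<le>n - i. d i j * x ^ i * y ^ j)"
    using assms unfolding polys2_def by blast
  then show ?thesis
    by (intro polys2I[where c = "\<lambda>i j. c * d i j"]) (simp add: sum_distrib_left algebra_simps)
qed

text \<open>Closure under linear combinations reduces statements about polynomials to monomials; this avoids
  handling coefficient arrays.\<close>

lemma polys2_induct [consumes 1, case_names monom add cmult]:
  assumes f: "f \<in> polys2 n"
    and monom: "\<And>i j. i + j \<le> n \<Longrightarrow> P (\<lambda>p. fst p ^ i * snd p ^ j)"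
    and add: "\<And>f g. P f \<Longrightarrow> P g \<Longrightarrow> P (\<lambda>p. f p + g p)"
    and cmult: "\<And>c f. P f \<Longrightarrow> P (\<lambda>p. c * f p)"
  shows "P f"
proof -
  obtain c where c: "\<And>x y. f (x, y) = (\<Sum>i\<le>n. \<Sum>j\<le>n - i. c i j * x ^ i * y ^ j)"
    using f unfolding polys2_def by blast
  have zero: "P (\<lambda>p. 0)" using cmult[OF monom[of 0 0], of 0] by simp
  have S: "P (\<lambda>p. \<Sum>k\<in>A. g k p)" if "finite A" "\<And>k. k \<in> A \<Longrightarrow> P (g k)" for A :: "nat set" and g
    using that by (induction A rule: finite_induct) (auto intro: zero add)
  have "P (\<lambda>p. \<Sum>i\<le>n. \<Sum>j\<le>n - i. c i j * (fst p ^ i * snd p ^ j))"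
    by (intro S cmult monom) auto
  also have "(\<lambda>p. \<Sum>i\<le>n. \<Sum>j\<le>n - i. c i j * (fst p ^ i * snd p ^ j)) = f"
    by (auto simp: c mult.assoc)
  finally show ?thesis .
qed

lemma polys2_const [simp]: "(\<lambda>p. c) \<in> polys2 n"
  using polys2_cmult[OF polys2_monom[of 0 0 n], of c] by simp

lemma polys2_diff: "f \<in> polys2 n \<Longrightarrow> g \<in> polys2 n \<Longrightarrow> (\<lambda>p. f p - g p) \<in> polys2 n"
  using polys2_add[of f n "\<lambda>p. (-1) * g p"] polys2_cmult[of g n "-1"] by simp

lemma polys2_fst: "fst \<in> polys2 (Suc n)" and polys2_snd: "snd \<in> polys2 (Suc n)"
  using polys2_monom[of 1 0 "Suc n"] polys2_monom[of 0 1 "Suc n"] by simp_all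

lemma polys2_sum: "(\<And>k. k \<in> A \<Longrightarrow> f k \<in> polys2 n) \<Longrightarrow> (\<lambda>p. \<Sum>k\<in>A. f k p) \<in> polys2 n"
  by (induction A rule: infinite_finite_induct) (auto intro: polys2_add)

lemma polys2_mono:
  assumes "f \<in> polys2 m" "m \<le> n"
  shows "f \<in> polys2 n"
  using assms(1)
  by (induction rule: polys2_induct) (use assms(2) in \<open>auto intro: polys2_monom polys2_add polys2_cmult\<close>)

lemma polys2_mult:
  assumes "f \<in> polys2 m" "g \<in> polys2 n"
  shows "(\<lambda>p. f p * g p) \<in> polys2 (m + n)"
  using assms(1)
proof (induction rule: polys2_induct)
  case (monom i j)
  show ?case using assms(2)
  proof (induction rule: polys2_induct)
    case (monom k l)
    have "(\<lambda>p. fst p ^ (i + k) * snd p ^ (j + l)) \<in> polys2 (m + n)"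
      using \<open>i + j \<le> m\<close> monom by (intro polys2_monom) simp
    then show ?case by (simp add: power_add mult.commute mult.left_commute)
  next
    case (add f g) then show ?case using polys2_add by (fastforce simp: distrib_left)
  next
    case (cmult c f)
    from polys2_cmult[OF this, of c] show ?case by (simp add: mult.left_commute)
  qed
next
  case (add f g) then show ?case using polys2_add by (fastforce simp: distrib_right)
next
  case (cmult c f)
  from polys2_cmult[OF this, of c] show ?case by (simp add: mult.assoc)
qed

lemma polys2_power: "f \<in> polys2 m \<Longrightarrow> (\<lambda>p. f p ^ k) \<in> polys2 (k * m)"
  by (induction k) (auto dest: polys2_mult)

lemma polys2_compose:
  assumes f: "f \<in> polys2 n" and g: "g \<in> polys2 k" "h \<in> polys2 k"
  shows "(\<lambda>p. f (g p, h p)) \<in> polys2 (n * k)"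
  using f
proof (induction rule: polys2_induct)
  case (monom i j)
  have "(\<lambda>p. g p ^ i * h p ^ j) \<in> polys2 (i * k + j * k)"
    by (intro polys2_mult polys2_power g)
  moreover have "i * k + j * k \<le> n * k" using monom by (metis add_mult_distrib mult_le_mono1)
  ultimately show ?case using polys2_mono by auto
qed (auto intro: polys2_add polys2_cmult)

lemma continuous_on_polys2:
  assumes "f \<in> polys2 n" shows "continuous_on S f"
  using assms by (induction rule: polys2_induct) (auto intro!: continuous_intros)

lemma polys2_section:
  assumes "f \<in> polys2 n"
  shows "\<exists>a. \<forall>t. f (x, t) = (\<Sum>k\<le>n. a k * t ^ k)"
  using assms
proof (induction rule: polys2_induct)
  case (monom i j)
  have "(\<Sum>k\<le>n. (if k = j then x ^ i else 0) * t ^ k) = x ^ i * t ^ j" for t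
    using monom by (simp add: if_distrib[of "\<lambda>u. u * _"] cong: if_cong)
  then show ?case by (intro exI[of _ "\<lambda>k. if k = j then x ^ i else 0"]) simp
next
  case (add f g)
  then obtain a b where "\<forall>t. f (x, t) = (\<Sum>k\<le>n. a k * t ^ k)" "\<forall>t. g (x, t) = (\<Sum>k\<le>n. b k * t ^ k)"
    by blast
  then show ?case by (intro exI[of _ "\<lambda>k. a k + b k"]) (simp add: sum.distrib algebra_simps)
next
  case (cmult c f)
  then obtain a where "\<forall>t. f (x, t) = (\<Sum>k\<le>n. a k * t ^ k)"
    by blast
  then show ?case by (intro exI[of _ "\<lambda>k. c * a k"]) (simp add: sum_distrib_left algebra_simps)
qed

lemma polys2_section_finite_zeros:
  assumes "f \<in> polys2 n" "f (x, t0) \<noteq> 0"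
  shows "finite {t. f (x, t) = 0}"
proof -
  obtain a where a: "\<And>t. f (x, t) = (\<Sum>k\<le>n. a k * t ^ k)"
    using polys2_section[OF assms(1)] by blast
  have "\<exists>k\<le>n. a k \<noteq> 0"
  proof (rule ccontr)
    assume "\<not> (\<exists>k\<le>n. a k \<noteq> 0)"
    then show False using assms(2) by (simp add: a)
  qed
  then show ?thesis unfolding a using polyfun_finite_roots[of a n] by blast
qed

lemma AE_lborel_finite: "finite A \<Longrightarrow> AE x in (lborel :: real measure). x \<notin> A"
  by (rule AE_I'[of A]) (auto intro: finite_imp_null_set_lborel)

text \<open>By Fubini: a nonzero value at \<open>(x\<^sub>0, y\<^sub>0)\<close> makes the section at height \<open>y\<^sub>0\<close> nonzero for all but finitely
  many \<open>x\<close>, and for each of these the vertical section has only finitely many zeros.\<close>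

theorem polys2_AE_nonzero:
  assumes f: "f \<in> polys2 n" and nz: "f (x0, y0) \<noteq> 0"
  shows "AE p in lebesgue. f p \<noteq> 0"
proof -
  have "(\<lambda>p. f (snd p, fst p)) \<in> polys2 (n * 1)"
    by (rule polys2_compose[OF f]) (auto simp: polys2_fst[of 0, simplified] polys2_snd[of 0, simplified])
  from polys2_section_finite_zeros[OF this, of y0 x0] nz
  have "finite {x. f (x, y0) = 0}" by simp
  from AE_lborel_finite[OF this]
  have 1: "AE x in lborel. f (x, y0) \<noteq> 0" by simp
  have "AE x in lborel. AE y in lborel. f (x, y) \<noteq> 0"
  proof (use 1 in eventually_elim)
    fix x assume "f (x, y0) \<noteq> 0"
    from AE_lborel_finite[OF polys2_section_finite_zeros[OF f this]]
    show "AE y in lborel. f (x, y) \<noteq> 0" by simp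
  qed
  moreover have [measurable]: "f \<in> borel_measurable borel"
    by (rule borel_measurable_continuous_onI) (rule continuous_on_polys2[OF f])
  have "{x \<in> space (lborel \<Otimes>\<^sub>M lborel). f x \<noteq> 0} \<in> sets (lborel \<Otimes>\<^sub>M lborel)"
    unfolding lborel_prod by measurable
  ultimately have "AE p in lborel \<Otimes>\<^sub>M lborel. f p \<noteq> 0"
    by (intro lborel_pair.AE_pair_measure) auto
  then show ?thesis unfolding lborel_prod by (rule AE_completion)
qed

lemma polys2_zero_if_zero_on_open:
  assumes f: "f \<in> polys2 n" and S: "open S" "S \<noteq> {}" "\<And>p. p \<in> S \<Longrightarrow> f p = 0"
  shows "f p = 0"
proof (rule ccontr)
  assume "f p \<noteq> 0"
  then have "AE p in lebesgue. f p \<noteq> 0" using polys2_AE_nonzero[OF f, of "fst p" "snd p"] by simp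
  then have "AE p in lebesgue. p \<notin> S" by eventually_elim (use S(3) in auto)
  then have "negligible S" using S(1) 
    by (simp add: negligible_iff_null_sets AE_iff_null_sets borel_open)
  then show False using S open_not_negligible by blast
qed

section \<open>Reproducing kernels of definite weights\<close>

text \<open>Gram-Schmidt. The functions \<open>\<phi> k\<close> are an orthonormal basis of the span of the \<open>b i\<close>, built up one
  \<open>b i\<close> at a time by normalizing the component orthogonal to the functions already found, unless
  that component is zero. Only the resulting expansion is recorded, since the reproducing kernel is
  read off from it.\<close>

lemma exists_fourier_expansion:
  fixes b :: "'k \<Rightarrow> 'a \<Rightarrow> real" and ip :: "('a \<Rightarrow> real) \<Rightarrow> ('a \<Rightarrow> real) \<Rightarrow> real"
  assumes "finite A"
    and b: "\<And>k. k \<in> A \<Longrightarrow> b k \<in> V"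
    and V_add: "\<And>f g. f \<in> V \<Longrightarrow> g \<in> V \<Longrightarrow> (\<lambda>x. f x + g x) \<in> V"
    and V_cmult: "\<And>c f. f \<in> V \<Longrightarrow> (\<lambda>x. c * f x) \<in> V"
    and V_zero: "(\<lambda>x. 0) \<in> V"
    and ip_commute: "\<And>f g. f \<in> V \<Longrightarrow> g \<in> V \<Longrightarrow> ip f g = ip g f"
    and ip_add: "\<And>f g h. f \<in> V \<Longrightarrow> g \<in> V \<Longrightarrow> h \<in> V \<Longrightarrow> ip (\<lambda>x. f x + g x) h = ip f h + ip g h"
    and ip_cmult: "\<And>c f h. f \<in> V \<Longrightarrow> h \<in> V \<Longrightarrow> ip (\<lambda>x. c * f x) h = c * ip f h"
    and ip_nonneg: "\<And>f. f \<in> V \<Longrightarrow> ip f f \<ge> 0"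
    and ip_eq_0: "\<And>f. f \<in> V \<Longrightarrow> ip f f = 0 \<Longrightarrow> f = (\<lambda>x. 0)"
  shows "\<exists>m. \<exists>\<phi> :: nat \<Rightarrow> 'a \<Rightarrow> real. (\<forall>k<m. \<phi> k \<in> V) \<and>
     (\<forall>c. \<forall>x. (\<Sum>i\<in>A. c i * b i x) = (\<Sum>k<m. ip (\<lambda>x. \<Sum>i\<in>A. c i * b i x) (\<phi> k) * \<phi> k x))"
proof -
  have V_sum: "(\<lambda>x. \<Sum>i\<in>I. f i x) \<in> V" if "\<And>i. i \<in> I \<Longrightarrow> f i \<in> V" for I :: "'i set" and f
    using that by (induction I rule: infinite_finite_induct) (auto intro: V_add V_zero)
  have ip_zero: "ip (\<lambda>x. 0) h = 0" if "h \<in> V" for h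
    using ip_cmult[OF V_zero that, of 0] by simp
  have ip_sum: "ip (\<lambda>x. \<Sum>i\<in>I. f i x) h = (\<Sum>i\<in>I. ip (f i) h)"
    if "\<And>i. i \<in> I \<Longrightarrow> f i \<in> V" "h \<in> V" for I :: "nat set" and f h
    using that by (induction I rule: infinite_finite_induct)
       (auto simp: ip_zero ip_add V_sum)
  have "\<exists>m. \<exists>\<phi> :: nat \<Rightarrow> 'a \<Rightarrow> real. (\<forall>k<m. \<phi> k \<in> V) \<and>
     (\<forall>k<m. \<forall>l<m. ip (\<phi> k) (\<phi> l) = (if k = l then 1 else 0)) \<and>
     (\<forall>i\<in>A. \<forall>x. b i x = (\<Sum>k<m. ip (b i) (\<phi> k) * \<phi> k x))"
    using \<open>finite A\<close> b
  proof (induction A rule: finite_induct)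
    case empty then show ?case by (auto intro!: exI[of _ 0])
  next
    case (insert j A)
    then obtain m and \<phi> :: "nat \<Rightarrow> 'a \<Rightarrow> real"
      where phi: "\<And>k. k < m \<Longrightarrow> \<phi> k \<in> V"
        and on: "\<And>k l. k < m \<Longrightarrow> l < m \<Longrightarrow> ip (\<phi> k) (\<phi> l) = (if k = l then 1 else 0)"
        and ex: "\<And>i x. i \<in> A \<Longrightarrow> b i x = (\<Sum>k<m. ip (b i) (\<phi> k) * \<phi> k x)"
      by auto blast
    have bj: "b j \<in> V" using insert by simp
    \<comment> \<open>The component of \<open>b j\<close> orthogonal to the functions found so far.\<close>
    define r where "r x = b j x + (-1) * (\<Sum>k<m. ip (b j) (\<phi> k) * \<phi> k x)" for x
    have pV: "(\<lambda>x. \<Sum>k<m. ip (b j) (\<phi> k) * \<phi> k x) \<in> V"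
      by (auto intro!: V_sum V_cmult phi)
    have rV: "r \<in> V" unfolding r_def by (intro V_add V_cmult bj pV)
    have ipp: "ip (\<lambda>x. \<Sum>k<m. ip (b j) (\<phi> k) * \<phi> k x) (\<phi> l) = ip (b j) (\<phi> l)" if l: "l < m" for l
    proof -
      have "ip (\<lambda>x. \<Sum>k<m. ip (b j) (\<phi> k) * \<phi> k x) (\<phi> l) = (\<Sum>k<m. ip (\<lambda>x. ip (b j) (\<phi> k) * \<phi> k x) (\<phi> l))"
        by (rule ip_sum) (auto intro: V_cmult phi l)
      also have "\<dots> = (\<Sum>k<m. if k = l then ip (b j) (\<phi> l) else 0)"
        by (intro sum.cong refl, subst ip_cmult) (auto simp: phi l on)
      finally show ?thesis using l by simp
    qed
    have r_orth: "ip r (\<phi> l) = 0" if l: "l < m" for l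
    proof -
      have "ip r (\<phi> l) = ip (b j) (\<phi> l) + (-1) * ip (\<lambda>x. \<Sum>k<m. ip (b j) (\<phi> k) * \<phi> k x) (\<phi> l)"
        unfolding r_def using ip_add[OF bj V_cmult[OF pV, of "-1"] phi[OF l]] ip_cmult[OF pV phi[OF l], of "-1"]
        by simp
      then show ?thesis by (simp add: ipp[OF l])
    qed
    show ?case
    proof (cases "ip r r = 0")
      case True
      then have "r = (\<lambda>x. 0)" using ip_eq_0 rV by blast
      then have "r x = 0" for x by simp
      then have "b j x = (\<Sum>k<m. ip (b j) (\<phi> k) * \<phi> k x)" for x
        by (simp add: r_def)
      then show ?thesis using phi on ex by (intro exI[of _ m] exI[of _ \<phi>]) auto
    next
      case False
      define q where "q = sqrt (ip r r)"
      have q: "q > 0" "q * q = ip r r" using False ip_nonneg[OF rV] by (auto simp: q_def)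
      define e where "e x = (1 / q) * r x" for x
      have eV: "e \<in> V" unfolding e_def by (intro V_cmult rV)
      have ip_e: "ip e h = (1 / q) * ip r h" if "h \<in> V" for h
        unfolding e_def by (rule ip_cmult[OF rV that])
      have e_orth: "ip e (\<phi> l) = 0" "ip (\<phi> l) e = 0" if "l < m" for l
        using ip_e[OF phi[OF that]] r_orth[OF that] ip_commute[OF eV phi[OF that]] by auto
      have ip_re: "ip r e = q"
      proof -
        have "ip r e = ip e r" by (rule ip_commute[OF rV eV])
        also have "\<dots> = (1 / q) * (q * q)" by (simp only: ip_e[OF rV] q(2))
        finally show ?thesis using q(1) by simp
      qed
      have ee: "ip e e = 1"
        using q(1) by (simp add: ip_e[OF eV] ip_re)
      have be: "ip (b j) e = q"
      proof -
        have "ip r e = ip (b j) e + (-1) * ip (\<lambda>x. \<Sum>k<m. ip (b j) (\<phi> k) * \<phi> k x) e"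
          unfolding r_def using ip_add[OF bj V_cmult[OF pV, of "-1"] eV] ip_cmult[OF pV eV, of "-1"]
          by simp
        also have "ip (\<lambda>x. \<Sum>k<m. ip (b j) (\<phi> k) * \<phi> k x) e = (\<Sum>k<m. ip (\<lambda>x. ip (b j) (\<phi> k) * \<phi> k x) e)"
          by (rule ip_sum) (auto intro: V_cmult phi eV)
        also have "\<dots> = 0" by (intro sum.neutral ballI, subst ip_cmult) (auto simp: phi eV e_orth)
        finally show ?thesis using ip_re by simp
      qed
      define \<psi> where "\<psi> k = (if k < m then \<phi> k else e)" for k
      have exj: "b j x = (\<Sum>k<m. ip (b j) (\<phi> k) * \<phi> k x) + ip (b j) e * e x" for x
        using q by (simp add: be e_def r_def)
      have exA: "ip (b i) e = 0" if i: "i \<in> A" for i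
      proof -
        have "b i = (\<lambda>x. \<Sum>k<m. ip (b i) (\<phi> k) * \<phi> k x)" using ex[OF i] by blast
        then have "ip (b i) e = ip (\<lambda>x. \<Sum>k<m. ip (b i) (\<phi> k) * \<phi> k x) e" by simp
        also have "\<dots> = (\<Sum>k<m. ip (\<lambda>x. ip (b i) (\<phi> k) * \<phi> k x) e)"
          by (rule ip_sum) (auto intro: V_cmult phi eV)
        also have "\<dots> = 0" by (intro sum.neutral ballI, subst ip_cmult) (auto simp: phi eV e_orth)
        finally show ?thesis .
      qed
      show ?thesis
      proof (intro exI[of _ "Suc m"] exI[of _ \<psi>] conjI allI impI ballI)
        fix k assume "k < Suc m" then show "\<psi> k \<in> V" by (auto simp: \<psi>_def phi eV)
      next
        fix k l assume "k < Suc m" "l < Suc m"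
        then show "ip (\<psi> k) (\<psi> l) = (if k = l then 1 else 0)"
          by (auto simp: \<psi>_def on ee e_orth)
      next
        fix i x assume "i \<in> insert j A"
        then show "b i x = (\<Sum>k<Suc m. ip (b i) (\<psi> k) * \<psi> k x)"
          by (auto simp: \<psi>_def exj exA ex[symmetric])
      qed
    qed
  qed
  then obtain m and \<phi> :: "nat \<Rightarrow> 'a \<Rightarrow> real"
    where phi: "\<And>k. k < m \<Longrightarrow> \<phi> k \<in> V"
      and ex: "\<And>i x. i \<in> A \<Longrightarrow> b i x = (\<Sum>k<m. ip (b i) (\<phi> k) * \<phi> k x)"
    by blast
  have "(\<Sum>i\<in>A. c i * b i x) = (\<Sum>k<m. ip (\<lambda>x. \<Sum>i\<in>A. c i * b i x) (\<phi> k) * \<phi> k x)" for c x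
  proof -
    have ips: "ip (\<lambda>x. \<Sum>i\<in>A. c i * b i x) (\<phi> k) = (\<Sum>i\<in>A. c i * ip (b i) (\<phi> k))" if k: "k < m" for k
      using \<open>finite A\<close> b
    proof (induction A rule: finite_induct)
      case empty then show ?case by (simp add: ip_zero phi k)
    next
      case (insert j A)
      have "ip (\<lambda>x. c j * b j x + (\<Sum>i\<in>A. c i * b i x)) (\<phi> k) = ip (\<lambda>x. c j * b j x) (\<phi> k) + ip (\<lambda>x. \<Sum>i\<in>A. c i * b i x) (\<phi> k)"
        using insert by (intro ip_add V_sum V_cmult phi k) auto
      then show ?case using insert by (simp add: ip_cmult phi k)
    qed
    have "(\<Sum>i\<in>A. c i * b i x) = (\<Sum>i\<in>A. \<Sum>k<m. c i * ip (b i) (\<phi> k) * \<phi> k x)"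
      using ex by (intro sum.cong) (auto simp: sum_distrib_left mult.assoc)
    also have "\<dots> = (\<Sum>k<m. \<Sum>i\<in>A. c i * ip (b i) (\<phi> k) * \<phi> k x)" by (rule sum.swap)
    also have "\<dots> = (\<Sum>k<m. ip (\<lambda>x. \<Sum>i\<in>A. c i * b i x) (\<phi> k) * \<phi> k x)"
      by (intro sum.cong) (auto simp: ips sum_distrib_right)
    finally show ?thesis .
  qed
  then show ?thesis using phi by blast
qed

text \<open>Exactly what makes \<open>(f, g) \<mapsto> \<integral> f g W\<close> a well-defined inner product on the polynomials of each
  degree.\<close>

definition definite_weight :: "(real \<times> real) set \<Rightarrow> (real \<times> real \<Rightarrow> real) \<Rightarrow> bool" where
  "definite_weight D W \<longleftrightarrow> (\<forall>n. \<forall>f \<in> polys2 n.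
     integrable (lebesgue_on D) (\<lambda>x. f x * W x) \<and>
     0 \<le> (LINT x|lebesgue_on D. f x * f x * W x) \<and>
     ((LINT x|lebesgue_on D. f x * f x * W x) = 0 \<longrightarrow> f = (\<lambda>x. 0)))"

lemma definite_weightD:
  assumes "definite_weight D W" "f \<in> polys2 n"
  shows "integrable (lebesgue_on D) (\<lambda>x. f x * W x)"
    and "0 \<le> (LINT x|lebesgue_on D. f x * f x * W x)"
    and "(LINT x|lebesgue_on D. f x * f x * W x) = 0 \<Longrightarrow> f = (\<lambda>x. 0)"
  using assms unfolding definite_weight_def by blast+

text \<open>The kernel is \<open>\<Sum>k. \<phi> k x * \<phi> k y\<close> for an orthonormal basis \<open>\<phi>\<close>. As an identity between
  polynomials in \<open>x\<close>, the reproducing property holds for every \<open>x\<close> in the plane and not just on \<open>D\<close>. This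
  matters because \<open>quad_map\<close> sends the boundary and the diagonals of the square outside \<open>Omega\<close>.\<close>

lemma reproducing_kernel_exists:
  assumes W: "definite_weight D W"
  shows "\<exists>K. (\<forall>x. (\<lambda>y. K x y) \<in> polys2 n) \<and> (\<forall>y. (\<lambda>x. K x y) \<in> polys2 n) \<and>
     (\<forall>f \<in> polys2 n. \<forall>x. has_bochner_integral (lebesgue_on D) (\<lambda>y. K x y * f y * W y) (f x))"
proof -
  define ip where "ip f g = (LINT x|lebesgue_on D. f x * g x * W x)" for f g :: "real \<times> real \<Rightarrow> real"
  define A where "A = (SIGMA i:{..n}. {..n - i})"
  define b where "b = (\<lambda>(i, j). \<lambda>p :: real \<times> real. fst p ^ i * snd p ^ j)"
  have int: "integrable (lebesgue_on D) (\<lambda>x. f x * g x * W x)" if "f \<in> polys2 n" "g \<in> polys2 n" for f g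
    using definite_weightD(1)[OF W polys2_mult[OF that]] .
  have "\<exists>m. \<exists>\<phi> :: nat \<Rightarrow> real \<times> real \<Rightarrow> real. (\<forall>k<m. \<phi> k \<in> polys2 n) \<and>
     (\<forall>c. \<forall>x. (\<Sum>i\<in>A. c i * b i x) = (\<Sum>k<m. ip (\<lambda>x. \<Sum>i\<in>A. c i * b i x) (\<phi> k) * \<phi> k x))"
  proof (rule exists_fourier_expansion)
    show "b k \<in> polys2 n" if "k \<in> A" for k
      using that by (auto simp: A_def b_def intro!: polys2_monom)
    show "ip f g = ip g f" for f g by (simp add: ip_def mult.commute)
    show "ip (\<lambda>x. f x + g x) h = ip f h + ip g h" if "f \<in> polys2 n" "g \<in> polys2 n" "h \<in> polys2 n" for f g h
      unfolding ip_def using int[OF that(1,3)] int[OF that(2,3)] by (simp add: distrib_right)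
    show "ip (\<lambda>x. c * f x) h = c * ip f h" for c f h
      unfolding ip_def by (simp add: mult.assoc)
    show "0 \<le> ip f f" if "f \<in> polys2 n" for f
      unfolding ip_def by (rule definite_weightD(2)[OF W that])
    show "f = (\<lambda>x. 0)" if "f \<in> polys2 n" "ip f f = 0" for f
      using definite_weightD(3)[OF W that(1)] that(2) unfolding ip_def by simp
  qed (auto simp: A_def intro: polys2_add polys2_cmult)
  then obtain m and \<phi> :: "nat \<Rightarrow> real \<times> real \<Rightarrow> real" where phi: "\<And>k. k < m \<Longrightarrow> \<phi> k \<in> polys2 n"
    and ex: "\<And>c x. (\<Sum>i\<in>A. c i * b i x) = (\<Sum>k<m. ip (\<lambda>x. \<Sum>i\<in>A. c i * b i x) (\<phi> k) * \<phi> k x)"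
    by blast
  have expand: "f x = (\<Sum>k<m. ip f (\<phi> k) * \<phi> k x)" if f: "f \<in> polys2 n" for f x
  proof -
    obtain c where c: "\<And>x y. f (x, y) = (\<Sum>i\<le>n. \<Sum>j\<le>n - i. c i j * x ^ i * y ^ j)"
      using f unfolding polys2_def by blast
    have "f p = (\<Sum>i\<in>A. (case i of (i, j) \<Rightarrow> c i j) * b i p)" for p
      by (cases p) (simp add: c A_def b_def sum.Sigma mult.assoc split_def)
    then have "f = (\<lambda>x. \<Sum>i\<in>A. (case i of (i, j) \<Rightarrow> c i j) * b i x)" by blast
    then show ?thesis using ex[of "\<lambda>(i, j). c i j" x] by simp
  qed
  show ?thesis
  proof (intro exI[of _ "\<lambda>x y. \<Sum>k<m. \<phi> k x * \<phi> k y"] conjI allI ballI)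
    fix f x assume f: "f \<in> polys2 n"
    have "has_bochner_integral (lebesgue_on D) (\<lambda>y. \<Sum>k<m. \<phi> k x * (f y * \<phi> k y * W y)) (\<Sum>k<m. \<phi> k x * ip f (\<phi> k))"
      unfolding ip_def
      by (intro has_bochner_integral_sum has_bochner_integral_mult_right has_bochner_integral_integrable int f phi) auto
    moreover have "(\<lambda>y. \<Sum>k<m. \<phi> k x * (f y * \<phi> k y * W y)) = (\<lambda>y. (\<Sum>k<m. \<phi> k x * \<phi> k y) * f y * W y)"
      by (auto simp: sum_distrib_right sum_distrib_left mult_ac intro!: sum.cong)
    moreover have "(\<Sum>k<m. \<phi> k x * ip f (\<phi> k)) = f x"
      using expand[OF f, of x] by (simp add: mult.commute)
    ultimately show "has_bochner_integral (lebesgue_on D) (\<lambda>y. (\<Sum>k<m. \<phi> k x * \<phi> k y) * f y * W y) (f x)"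
      by simp
  next
    fix y
    have "(\<lambda>x. \<Sum>k<m. \<phi> k y * \<phi> k x) \<in> polys2 n"
      by (intro polys2_sum polys2_cmult phi) simp
    then show "(\<lambda>x. \<Sum>k<m. \<phi> k x * \<phi> k y) \<in> polys2 n" by (simp add: mult.commute)
  qed (auto intro!: polys2_sum polys2_cmult phi)
qed

text \<open>For \<open>x \<in> D\<close> the difference \<open>h\<close> of the two kernels at \<open>x\<close> is orthogonal to all polynomials, in
  particular to itself. The open subset \<open>U\<close> is what extends equality from \<open>x \<in> D\<close> to all \<open>x\<close>.\<close>

lemma reproducing_kernel_unique:
  assumes W: "definite_weight D W" and U: "open U" "U \<noteq> {}" "U \<subseteq> D"
    and K: "is_reproducing_kernel D W n K" and L: "is_reproducing_kernel D W n L"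
  shows "K = L"
proof (intro ext)
  fix x y
  have eq: "K x y = L x y" if x: "x \<in> D" for x y
  proof -
    define h where "h y = K x y - L x y" for y
    have h: "h \<in> polys2 n"
      unfolding h_def using K L unfolding is_reproducing_kernel_def by (intro polys2_diff) blast+
    have "has_bochner_integral (lebesgue_on D) (\<lambda>y. K x y * h y * W y - L x y * h y * W y) (h x - h x)"
      using K L h x unfolding is_reproducing_kernel_def by (intro has_bochner_integral_diff) blast+
    then have "has_bochner_integral (lebesgue_on D) (\<lambda>y. h y * h y * W y) 0"
      by (simp add: h_def algebra_simps)
    then have "h = (\<lambda>x. 0)"
      by (intro definite_weightD(3)[OF W h] has_bochner_integral_integral_eq)
    then show ?thesis unfolding h_def by (metis eq_iff_diff_eq_0)
  qed
  have "(\<lambda>x. K x y - L x y) \<in> polys2 n"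
    using K L unfolding is_reproducing_kernel_def by (intro polys2_diff) blast+
  then have "K x y - L x y = 0"
    by (rule polys2_zero_if_zero_on_open[OF _ U(1,2)]) (metis eq U(3) subsetD diff_self)
  then show "K x y = L x y" by simp
qed

lemma reproducing_kernel_eqI:
  assumes "definite_weight D W" "open U" "U \<noteq> {}" "U \<subseteq> D" "is_reproducing_kernel D W n K"
  shows "reproducing_kernel D W (int n) = K"
proof -
  have "(THE K. is_reproducing_kernel D W n K) = K"
    by (rule the_equality[of "is_reproducing_kernel D W n", OF assms(5)])
      (rule reproducing_kernel_unique[OF assms(1-4) _ assms(5)])
  then show ?thesis by (simp add: reproducing_kernel_def)
qed

text \<open>The degree is an integer so that the components belonging to kernels of index \<open>-1\<close> fit the same
  pattern.\<close>

definition polysZ :: "int \<Rightarrow> (real \<times> real \<Rightarrow> real) set" where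
  "polysZ m = (if m < 0 then {\<lambda>p. 0} else polys2 (nat m))"

lemma polysZ_add: "f \<in> polysZ m \<Longrightarrow> g \<in> polysZ m \<Longrightarrow> (\<lambda>p. f p + g p) \<in> polysZ m"
  and polysZ_cmult: "f \<in> polysZ m \<Longrightarrow> (\<lambda>p. c * f p) \<in> polysZ m"
  using polys2_add polys2_cmult by (auto simp: polysZ_def split: if_splits)

lemma polysZ_mono: "f \<in> polysZ m \<Longrightarrow> m \<le> n \<Longrightarrow> f \<in> polysZ n"
  using polys2_mono[of f "nat m" "nat n"] by (auto simp: polysZ_def split: if_splits)

lemma polysZ_subset: "f \<in> polysZ m \<Longrightarrow> f \<in> polys2 (nat m)"
  by (auto simp: polysZ_def split: if_splits)

lemma polysZ_mult_poly:
  assumes "f \<in> polysZ m" "g \<in> polys2 k" "m + int k \<le> n"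
  shows "(\<lambda>p. g p * f p) \<in> polysZ n"
proof (cases "m < 0")
  case True then show ?thesis using assms by (simp add: polysZ_def)
next
  case False
  then have "(\<lambda>p. g p * f p) \<in> polys2 (k + nat m)" using assms by (intro polys2_mult) (auto simp: polysZ_def)
  moreover have "k + nat m \<le> nat n" "\<not> n < 0" using False assms by auto
  ultimately show ?thesis using polys2_mono by (simp add: polysZ_def)
qed

lemma reproducing_kernelD:
  assumes W: "definite_weight D W" and U: "open U" "U \<noteq> {}" "U \<subseteq> D"
  shows "(\<lambda>y. reproducing_kernel D W m x y) \<in> polysZ m"
    and "(\<lambda>x. reproducing_kernel D W m x y) \<in> polysZ m"
    and "f \<in> polysZ m \<Longrightarrow>
      has_bochner_integral (lebesgue_on D) (\<lambda>y. reproducing_kernel D W m x y * f y * W y) (f x)"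
proof -
  have "(\<lambda>y. reproducing_kernel D W m x y) \<in> polysZ m \<and> (\<lambda>x. reproducing_kernel D W m x y) \<in> polysZ m \<and>
    (f \<in> polysZ m \<longrightarrow>
      has_bochner_integral (lebesgue_on D) (\<lambda>y. reproducing_kernel D W m x y * f y * W y) (f x))"
  proof (cases "m < 0")
    case True
    then show ?thesis by (auto simp: polysZ_def reproducing_kernel_def)
  next
    case False
    obtain K where K: "\<forall>x. (\<lambda>y. K x y) \<in> polys2 (nat m)" "\<forall>y. (\<lambda>x. K x y) \<in> polys2 (nat m)"
     "\<forall>f \<in> polys2 (nat m). \<forall>x. has_bochner_integral (lebesgue_on D) (\<lambda>y. K x y * f y * W y) (f x)"
      using reproducing_kernel_exists[OF W, of "nat m"] by blast
    then have "is_reproducing_kernel D W (nat m) K"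
      unfolding is_reproducing_kernel_def by blast
    from reproducing_kernel_eqI[OF W U this] False have "reproducing_kernel D W m = K" by simp
    then show ?thesis using K False by (simp add: polysZ_def del: split_paired_All)
  qed
  then show "(\<lambda>y. reproducing_kernel D W m x y) \<in> polysZ m"
    "(\<lambda>x. reproducing_kernel D W m x y) \<in> polysZ m"
    "f \<in> polysZ m \<Longrightarrow>
      has_bochner_integral (lebesgue_on D) (\<lambda>y. reproducing_kernel D W m x y * f y * W y) (f x)"
    by blast+
qed

section \<open>Change of variables in the plane\<close>

text \<open>Weights are only Lebesgue measurable, so invariance of Borel measure has to be carried over
  to its completion.\<close>

lemma lebesgue_distr_eq:
  fixes \<phi> :: "'a::euclidean_space \<Rightarrow> 'b::euclidean_space"
  assumes [measurable]: "\<phi> \<in> borel \<rightarrow>\<^sub>M borel" and d: "distr lborel borel \<phi> = lborel"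
  shows measurable_lebesgue_of_distr_eq: "\<phi> \<in> lebesgue \<rightarrow>\<^sub>M lebesgue"
    and "distr lebesgue lebesgue \<phi> = lebesgue"
proof -
  have d': "distr lebesgue lborel \<phi> = lborel"
    using d by (subst distr_completion) (auto cong: distr_cong)
  have m: "\<phi> \<in> lebesgue \<rightarrow>\<^sub>M lborel" by (simp add: measurable_completion)
  show "\<phi> \<in> lebesgue \<rightarrow>\<^sub>M lebesgue"
    by (rule completion.measurable_completion2[OF m]) (simp add: d')
  have "completion (distr lebesgue lborel \<phi>) = distr lebesgue lebesgue \<phi>"
    by (rule completion.completion_distr_eq[OF m]) (simp add: d')
  then show "distr lebesgue lebesgue \<phi> = lebesgue" by (simp add: d')
qed

lemma has_bochner_integral_lebesgue_distr:
  fixes \<phi> :: "'a::euclidean_space \<Rightarrow> 'b::euclidean_space" and f :: "'b \<Rightarrow> real"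
  assumes "\<phi> \<in> borel \<rightarrow>\<^sub>M borel" "distr lborel borel \<phi> = lborel"
    and "has_bochner_integral lebesgue f i"
  shows "has_bochner_integral lebesgue (\<lambda>x. f (\<phi> x)) i"
proof -
  note m = lebesgue_distr_eq[OF assms(1,2)]
  have f: "f \<in> borel_measurable lebesgue"
    using assms(3) has_bochner_integral_iff borel_measurable_integrable by blast
  show ?thesis
    using assms(3) integrable_distr_eq[OF m(1) f] integral_distr[OF m(1) f] m(2)
    by (simp add: has_bochner_integral_iff)
qed

lemma distr_uminus_lborel: "distr lborel borel uminus = (lborel :: 'a::euclidean_space measure)"
  using lborel_affine[of "-1" "0::'a"] by (simp add: density_1)

lemma distr_swap_lborel:
  "distr lborel borel prod.swap = (lborel :: (real \<times> real) measure)"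
proof -
  have "lborel \<Otimes>\<^sub>M lborel = distr (lborel \<Otimes>\<^sub>M lborel) (lborel \<Otimes>\<^sub>M lborel) (\<lambda>(x::real, y::real). (y, x))"
    by (rule lborel_pair.distr_pair_swap)
  moreover have "(\<lambda>(x::real, y::real). (y, x)) = prod.swap" by auto
  ultimately have "lborel = distr lborel lborel (prod.swap :: real \<times> real \<Rightarrow> _)"
    by (simp add: lborel_prod)
  then show ?thesis by (simp cong: distr_cong)
qed

lemma has_bochner_integral_plane_uminus:
    "has_bochner_integral lebesgue f i \<Longrightarrow> has_bochner_integral lebesgue (\<lambda>x. f (- x)) i"
  and has_bochner_integral_plane_swap:
    "has_bochner_integral lebesgue f i \<Longrightarrow> has_bochner_integral lebesgue (\<lambda>x. f (prod.swap x)) i"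
  for f :: "real \<times> real \<Rightarrow> real"
proof -
  have m: "uminus \<in> borel_measurable (borel :: (real \<times> real) measure)"
     "prod.swap \<in> borel_measurable (borel :: (real \<times> real) measure)"
    by (auto intro!: borel_measurable_continuous_onI continuous_intros)
  show "has_bochner_integral lebesgue f i \<Longrightarrow> has_bochner_integral lebesgue (\<lambda>x. f (- x)) i"
    by (rule has_bochner_integral_lebesgue_distr[OF m(1) distr_uminus_lborel])
  show "has_bochner_integral lebesgue f i \<Longrightarrow> has_bochner_integral lebesgue (\<lambda>x. f (prod.swap x)) i"
    by (rule has_bochner_integral_lebesgue_distr[OF m(2) distr_swap_lborel])
qed

text \<open>The substitution rule for multidimensional integrals is formulated on \<open>real ^ 'n\<close>, whereas the
  weights live on \<open>real \<times> real\<close>. These two maps identify the planes and preserve Lebesgue measure.\<close>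

definition of_vec2 :: "real ^ 2 \<Rightarrow> real \<times> real" where
  "of_vec2 v = (v $ 1, v $ 2)"

definition to_vec2 :: "real \<times> real \<Rightarrow> real ^ 2" where
  "to_vec2 p = vector [fst p, snd p]"

lemma of_to_vec2 [simp]: "of_vec2 (to_vec2 p) = p" "to_vec2 (of_vec2 v) = v"
  by (auto simp: of_vec2_def to_vec2_def vec_eq_iff forall_2)

lemma linear_of_vec2: "linear of_vec2" and linear_to_vec2: "linear to_vec2"
  by (auto intro!: linearI simp: of_vec2_def to_vec2_def vec_eq_iff forall_2)

lemma measurable_vec2 [measurable]: "of_vec2 \<in> borel \<rightarrow>\<^sub>M borel" "to_vec2 \<in> borel \<rightarrow>\<^sub>M borel"
  by (auto intro!: borel_measurable_continuous_onI linear_continuous_on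
     simp: linear_conv_bounded_linear[symmetric] linear_of_vec2 linear_to_vec2)

lemma distr_of_vec2: "distr lborel borel of_vec2 = lborel"
proof (rule lborel_eqI[symmetric])
  fix l u :: "real \<times> real" assume le: "\<And>b. b \<in> Basis \<Longrightarrow> l \<bullet> b \<le> u \<bullet> b"
  have "(1, 0) \<in> (Basis :: (real \<times> real) set)" "(0, 1) \<in> (Basis :: (real \<times> real) set)" by (auto simp: Basis_prod_def)
  from le[OF this(1)] le[OF this(2)] have l: "fst l \<le> fst u" "snd l \<le> snd u"
    by (auto simp: inner_prod_def)
  have v: "of_vec2 -` box l u = box (to_vec2 l) (to_vec2 u)"
    by (auto simp: box_def Basis_vec_def inner_axis forall_2 of_vec2_def to_vec2_def Basis_prod_def inner_prod_def)
  have B: "(Basis :: (real ^ 2) set) = {axis 1 1, axis 2 1}"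
    by (auto simp: Basis_vec_def UNIV_2)
  have B2: "(Basis :: (real \<times> real) set) = {(1,0),(0,1)}" by (auto simp: Basis_prod_def)
  have ne: "axis 1 1 \<noteq> (axis 2 1 :: real ^ 2)" by (simp add: axis_eq_axis)
  show "emeasure (distr lborel borel of_vec2) (box l u) = (\<Prod>b\<in>Basis. (u - l) \<bullet> b)"
    using l by (simp add: emeasure_distr v emeasure_lborel_box_eq B B2 ne inner_axis to_vec2_def inner_prod_def)
qed simp

lemma distr_to_vec2: "distr lborel borel to_vec2 = lborel"
proof -
  have "distr lborel borel to_vec2 = distr (distr lborel borel of_vec2) borel to_vec2"
    by (simp add: distr_of_vec2)
  also have "\<dots> = distr lborel borel (to_vec2 \<circ> of_vec2)" by (subst distr_distr) auto
  also have "to_vec2 \<circ> of_vec2 = id" by auto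
  finally show ?thesis by (simp add: distr_id2 id_def)
qed

lemma has_bochner_integral_of_vec2_iff:
  fixes f :: "real \<times> real \<Rightarrow> real"
  shows "has_bochner_integral lebesgue (\<lambda>v. f (of_vec2 v)) i \<longleftrightarrow> has_bochner_integral lebesgue f i"
  using has_bochner_integral_lebesgue_distr[OF measurable_vec2(1) distr_of_vec2, of f i]
    has_bochner_integral_lebesgue_distr[OF measurable_vec2(2) distr_to_vec2, of "\<lambda>v. f (of_vec2 v)" i]
  by auto

lemma vec2_change_of_variables:
  fixes f :: "real ^ 2 \<Rightarrow> real" and g :: "real ^ 2 \<Rightarrow> real ^ 2"
  assumes S: "S \<in> sets lebesgue" "g ` S \<in> sets lebesgue"
    and der_g: "\<And>x. x \<in> S \<Longrightarrow> (g has_derivative g' x) (at x within S)"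
    and inj: "inj_on g S"
  shows "has_bochner_integral lebesgue (\<lambda>x. indicator S x * (\<bar>det (matrix (g' x))\<bar> * f (g x))) b
    \<longleftrightarrow> has_bochner_integral lebesgue (\<lambda>x. indicator (g ` S) x * f x) b"
proof -
  have *: "has_bochner_integral lebesgue (\<lambda>x. indicator T x * h x) b \<longleftrightarrow>
      h absolutely_integrable_on T \<and> integral T h = b" for T and h :: "real ^ 2 \<Rightarrow> real"
    using set_lebesgue_integral_eq_integral(2)[of T h]
    by (auto simp: has_bochner_integral_iff set_integrable_def set_lebesgue_integral_def)
  show ?thesis
    unfolding *
    using has_absolute_integral_change_of_variables[OF S(1) der_g inj, of "\<lambda>x. vec (f x) :: real ^ 1" "vec b"]
    by (auto simp: absolutely_integrable_on_1_iff integral_on_1_eq vec_eq_iff)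
qed

text \<open>The four functions \<open>a\<close>, \<open>b\<close>, \<open>c\<close>, \<open>d\<close> are the entries of the Jacobian matrix of \<open>g\<close>.\<close>

theorem plane_change_of_variables:
  fixes f :: "real \<times> real \<Rightarrow> real" and g :: "real \<times> real \<Rightarrow> real \<times> real"
  assumes S: "open S" "open (g ` S)"
    and der_g: "\<And>x. x \<in> S \<Longrightarrow> (g has_derivative (\<lambda>h. (a x * fst h + b x * snd h, c x * fst h + d x * snd h))) (at x)"
    and inj: "inj_on g S"
  shows "has_bochner_integral lebesgue (\<lambda>x. indicator S x * (\<bar>a x * d x - b x * c x\<bar> * f (g x))) i
    \<longleftrightarrow> has_bochner_integral lebesgue (\<lambda>x. indicator (g ` S) x * f x) i"
proof -
  define S' where "S' = of_vec2 -` S"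
  define G where "G = (\<lambda>v. to_vec2 (g (of_vec2 v)))"
  define G' where "G' = (\<lambda>v h. to_vec2 (let x = of_vec2 v; h = of_vec2 h in
     (a x * fst h + b x * snd h, c x * fst h + d x * snd h)))"
  have co: "continuous_on UNIV of_vec2"
    by (simp add: linear_continuous_on linear_conv_bounded_linear[symmetric] linear_of_vec2)
  have GS: "G ` S' = of_vec2 -` (g ` S)"
  proof (intro equalityI subsetI)
    fix v assume "v \<in> of_vec2 -` (g ` S)"
    then obtain x where "x \<in> S" "of_vec2 v = g x" by auto
    then show "v \<in> G ` S'" unfolding S'_def G_def
      by (intro image_eqI[where x = "to_vec2 x"]) (auto, metis of_to_vec2(2))
  qed (auto simp: G_def S'_def)
  have op: "open S'" "open (G ` S')"
    unfolding GS unfolding S'_def using S co by (auto intro!: open_vimage)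
  have der: "(G has_derivative G' v) (at v within S')" if "v \<in> S'" for v
  proof -
    have 1: "(of_vec2 has_derivative of_vec2) (at v within S')" "\<And>x T. (to_vec2 has_derivative to_vec2) (at x within T)"
      by (auto intro!: linear_imp_has_derivative linear_of_vec2 linear_to_vec2)
    have "of_vec2 v \<in> S" using that by (simp add: S'_def)
    from has_derivative_at_withinI[OF der_g[OF this]]
    have "((\<lambda>v. g (of_vec2 v)) has_derivative (\<lambda>h. (a (of_vec2 v) * fst (of_vec2 h) + b (of_vec2 v) * snd (of_vec2 h), c (of_vec2 v) * fst (of_vec2 h) + d (of_vec2 v) * snd (of_vec2 h)))) (at v within S')"
      by (rule has_derivative_in_compose[OF 1(1)])
    from has_derivative_in_compose[OF this 1(2)] show ?thesis
      by (simp add: G_def G'_def Let_def)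
  qed
  have inj': "inj_on G S'"
    using inj unfolding inj_on_def G_def S'_def by (metis of_to_vec2 vimage_eq)
  have det: "det (matrix (G' v)) = a (of_vec2 v) * d (of_vec2 v) - b (of_vec2 v) * c (of_vec2 v)" for v
    by (simp add: det_2 matrix_def G'_def Let_def to_vec2_def of_vec2_def axis_def)
  have "has_bochner_integral lebesgue (\<lambda>x. indicator S' x * (\<bar>det (matrix (G' x))\<bar> * f (of_vec2 (G x)))) i
    \<longleftrightarrow> has_bochner_integral lebesgue (\<lambda>x. indicator (G ` S') x * f (of_vec2 x)) i"
    by (rule vec2_change_of_variables) (use op der inj' in auto)
  also have "(\<lambda>x. indicator S' x * (\<bar>det (matrix (G' x))\<bar> * f (of_vec2 (G x)))) =
    (\<lambda>v. (\<lambda>x. indicator S x * (\<bar>a x * d x - b x * c x\<bar> * f (g x))) (of_vec2 v))"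
    by (auto simp: det G_def S'_def indicator_def)
  also have "(\<lambda>x. indicator (G ` S') x * f (of_vec2 x)) = (\<lambda>v. (\<lambda>x. indicator (g ` S) x * f x) (of_vec2 v))"
    by (auto simp: GS indicator_def)
  finally show ?thesis unfolding has_bochner_integral_of_vec2_iff[of "\<lambda>x. indicator S x * (\<bar>a x * d x - b x * c x\<bar> * f (g x))" i]
     has_bochner_integral_of_vec2_iff[of "\<lambda>x. indicator (g ` S) x * f x" i] .
qed

section \<open>Parity decomposition with respect to the two diagonals\<close>

text \<open>The components are numbered so that \<open>fij\<close> has the factor \<open>(x\<^sub>1 - x\<^sub>2)\<^sup>i (x\<^sub>1 + x\<^sub>2)\<^sup>j\<close>, whose square is
  the factor \<open>(1 - u + v)\<^sup>i (1 + u + v)\<^sup>j\<close> of the modified weights.\<close>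

definition parity_sum where
  "parity_sum f00 f01 f10 f11 = (\<lambda>x :: real \<times> real. f00 (quad_map x) + (fst x + snd x) * f01 (quad_map x)
    + (fst x - snd x) * f10 (quad_map x) + ((fst x)\<^sup>2 - (snd x)\<^sup>2) * (f11 (quad_map x) :: real))"

definition parity_decomposable where
  "parity_decomposable n f \<longleftrightarrow> (\<exists>f00 \<in> polysZ (int n div 2). \<exists>f01 \<in> polysZ ((int n - 1) div 2).
     \<exists>f10 \<in> polysZ ((int n - 1) div 2). \<exists>f11 \<in> polysZ (int n div 2 - 1). f = parity_sum f00 f01 f10 f11)"

lemma sum_square_quad_map: "1 + fst (quad_map x) + snd (quad_map x) = (fst x + snd x)\<^sup>2"
  and diff_square_quad_map: "1 - fst (quad_map x) + snd (quad_map x) = (fst x - snd x)\<^sup>2"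
  by (simp_all add: quad_map_def split_def power2_sum power2_diff)

lemma affine_polys2: "(\<lambda>p. 1 + fst p + snd p) \<in> polys2 1" "(\<lambda>p. 1 - fst p + snd p) \<in> polys2 1"
proof -
  have "fst \<in> polys2 1" "snd \<in> polys2 1" using polys2_fst[of 0] polys2_snd[of 0] by simp_all
  then show "(\<lambda>p. 1 + fst p + snd p) \<in> polys2 1" "(\<lambda>p. 1 - fst p + snd p) \<in> polys2 1"
    using polys2_add[OF polys2_add[OF polys2_const[of 1 1]]] polys2_add[OF polys2_diff[OF polys2_const[of 1 1]]]
    by blast+
qed

lemma parity_decomposable_add:
  assumes "parity_decomposable n f" "parity_decomposable n g"
  shows "parity_decomposable n (\<lambda>p. f p + g p)"
proof -
  obtain f00 f01 f10 f11 where f: "f00 \<in> polysZ (int n div 2)" "f01 \<in> polysZ ((int n - 1) div 2)"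
     "f10 \<in> polysZ ((int n - 1) div 2)" "f11 \<in> polysZ (int n div 2 - 1)" "f = parity_sum f00 f01 f10 f11"
    using assms(1) unfolding parity_decomposable_def by blast
  obtain g00 g01 g10 g11 where g: "g00 \<in> polysZ (int n div 2)" "g01 \<in> polysZ ((int n - 1) div 2)"
     "g10 \<in> polysZ ((int n - 1) div 2)" "g11 \<in> polysZ (int n div 2 - 1)" "g = parity_sum g00 g01 g10 g11"
    using assms(2) unfolding parity_decomposable_def by blast
  have "(\<lambda>p. f p + g p) = parity_sum (\<lambda>p. f00 p + g00 p) (\<lambda>p. f01 p + g01 p) (\<lambda>p. f10 p + g10 p) (\<lambda>p. f11 p + g11 p)"
    unfolding f(5) g(5) parity_sum_def by (simp add: algebra_simps)
  with f g show ?thesis unfolding parity_decomposable_def by (blast intro: polysZ_add)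
qed

lemma parity_decomposable_cmult:
  assumes "parity_decomposable n f"
  shows "parity_decomposable n (\<lambda>p. c * f p)"
proof -
  obtain f00 f01 f10 f11 where f: "f00 \<in> polysZ (int n div 2)" "f01 \<in> polysZ ((int n - 1) div 2)"
     "f10 \<in> polysZ ((int n - 1) div 2)" "f11 \<in> polysZ (int n div 2 - 1)" "f = parity_sum f00 f01 f10 f11"
    using assms(1) unfolding parity_decomposable_def by blast
  have "(\<lambda>p. c * f p) = parity_sum (\<lambda>p. c * f00 p) (\<lambda>p. c * f01 p) (\<lambda>p. c * f10 p) (\<lambda>p. c * f11 p)"
    unfolding f(5) parity_sum_def by (simp add: algebra_simps)
  with f show ?thesis unfolding parity_decomposable_def by (blast intro: polysZ_cmult)
qed

lemma parity_decomposable_mono: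
  assumes "parity_decomposable m f" "m \<le> n"
  shows "parity_decomposable n f"
proof -
  have "int m div 2 \<le> int n div 2" "(int m - 1) div 2 \<le> (int n - 1) div 2" "int m div 2 - 1 \<le> int n div 2 - 1"
    using assms(2) by auto
  then have "f \<in> polysZ (int m div 2) \<Longrightarrow> f \<in> polysZ (int n div 2)"
    "f \<in> polysZ ((int m - 1) div 2) \<Longrightarrow> f \<in> polysZ ((int n - 1) div 2)"
    "f \<in> polysZ (int m div 2 - 1) \<Longrightarrow> f \<in> polysZ (int n div 2 - 1)" for f
    by (blast intro: polysZ_mono)+
  with assms(1) show ?thesis unfolding parity_decomposable_def by blast
qed

text \<open>Multiplication by \<open>x\<^sub>1 + x\<^sub>2\<close> exchanges the components in pairs, and a component that acquires a
  second factor \<open>x\<^sub>1 + x\<^sub>2\<close> is multiplied by \<open>1 + u + v\<close>. The degree bounds are arranged to be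
  respected by this.\<close>

lemma parity_decomposable_mult_sum:
  assumes "parity_decomposable n f"
  shows "parity_decomposable (Suc n) (\<lambda>x. (fst x + snd x) * f x)"
proof -
  obtain f00 f01 f10 f11 where f: "f00 \<in> polysZ (int n div 2)" "f01 \<in> polysZ ((int n - 1) div 2)"
     "f10 \<in> polysZ ((int n - 1) div 2)" "f11 \<in> polysZ (int n div 2 - 1)" "f = parity_sum f00 f01 f10 f11"
    using assms(1) unfolding parity_decomposable_def by blast
  show ?thesis unfolding parity_decomposable_def
  proof (intro bexI)
    show "(\<lambda>x. (fst x + snd x) * f x) =
      parity_sum (\<lambda>p. (1 + fst p + snd p) * f01 p) f00 (\<lambda>p. (1 + fst p + snd p) * f11 p) f10"
      unfolding f(5) parity_sum_def sum_square_quad_map by (simp add: power2_eq_square algebra_simps)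
    show "(\<lambda>p. (1 + fst p + snd p) * f01 p) \<in> polysZ (int (Suc n) div 2)"
      by (rule polysZ_mult_poly[OF f(2) affine_polys2(1)]) auto
    show "(\<lambda>p. (1 + fst p + snd p) * f11 p) \<in> polysZ ((int (Suc n) - 1) div 2)"
      by (rule polysZ_mult_poly[OF f(4) affine_polys2(1)]) auto
    show "f00 \<in> polysZ ((int (Suc n) - 1) div 2)" by (rule polysZ_mono[OF f(1)]) auto
    show "f10 \<in> polysZ (int (Suc n) div 2 - 1)" by (rule polysZ_mono[OF f(3)]) auto
  qed
qed

lemma parity_decomposable_mult_diff:
  assumes "parity_decomposable n f"
  shows "parity_decomposable (Suc n) (\<lambda>x. (fst x - snd x) * f x)"
proof -
  obtain f00 f01 f10 f11 where f: "f00 \<in> polysZ (int n div 2)" "f01 \<in> polysZ ((int n - 1) div 2)"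
     "f10 \<in> polysZ ((int n - 1) div 2)" "f11 \<in> polysZ (int n div 2 - 1)" "f = parity_sum f00 f01 f10 f11"
    using assms(1) unfolding parity_decomposable_def by blast
  show ?thesis unfolding parity_decomposable_def
  proof (intro bexI)
    show "(\<lambda>x. (fst x - snd x) * f x) =
      parity_sum (\<lambda>p. (1 - fst p + snd p) * f10 p) (\<lambda>p. (1 - fst p + snd p) * f11 p) f00 f01"
      unfolding f(5) parity_sum_def diff_square_quad_map by (simp add: power2_eq_square algebra_simps)
    show "(\<lambda>p. (1 - fst p + snd p) * f10 p) \<in> polysZ (int (Suc n) div 2)"
      by (rule polysZ_mult_poly[OF f(3) affine_polys2(2)]) auto
    show "(\<lambda>p. (1 - fst p + snd p) * f11 p) \<in> polysZ ((int (Suc n) - 1) div 2)"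
      by (rule polysZ_mult_poly[OF f(4) affine_polys2(2)]) auto
    show "f00 \<in> polysZ ((int (Suc n) - 1) div 2)" by (rule polysZ_mono[OF f(1)]) auto
    show "f01 \<in> polysZ (int (Suc n) div 2 - 1)" by (rule polysZ_mono[OF f(2)]) auto
  qed
qed

text \<open>Both coordinates are combinations of \<open>x\<^sub>1 + x\<^sub>2\<close> and \<open>x\<^sub>1 - x\<^sub>2\<close>, so monomials arise from the
  constant \<open>1\<close> by the two multiplications above.\<close>

theorem polys2_parity_decomposable:
  assumes "f \<in> polys2 n"
  shows "parity_decomposable n f"
  using assms
proof (induction rule: polys2_induct)
  case (monom i j)
  have half: "parity_decomposable (Suc n) (\<lambda>x. fst x * f x)" "parity_decomposable (Suc n) (\<lambda>x. snd x * f x)"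
    if "parity_decomposable n f" for n f
    using parity_decomposable_cmult[OF parity_decomposable_add[OF parity_decomposable_mult_sum[OF that] parity_decomposable_mult_diff[OF that]], of "1/2"]
      parity_decomposable_cmult[OF parity_decomposable_add[OF parity_decomposable_mult_sum[OF that] parity_decomposable_cmult[OF parity_decomposable_mult_diff[OF that], of "-1"]], of "1/2"]
    by (simp_all add: algebra_simps)
  have "parity_decomposable 0 (\<lambda>x. 1)"
    unfolding parity_decomposable_def
    by (intro bexI[of _ "\<lambda>p. 1"] bexI[of _ "\<lambda>p. 0"]) (auto simp: parity_sum_def polysZ_def)
  then have "parity_decomposable j (\<lambda>x. snd x ^ j)"
    by (induction j) (auto dest: half(2))
  then have "parity_decomposable (i + j) (\<lambda>x. fst x ^ i * snd x ^ j)"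
    by (induction i) (auto dest: half(1) simp: mult.assoc)
  then show ?case using monom parity_decomposable_mono by blast
qed (auto intro: parity_decomposable_add parity_decomposable_cmult)

lemma quad_map_polys2: "(\<lambda>x. fst (quad_map x)) \<in> polys2 2" "(\<lambda>x. snd (quad_map x)) \<in> polys2 2"
proof -
  have "(\<lambda>x. 2 * (fst x ^ 1 * snd x ^ 1)) \<in> polys2 2" by (intro polys2_cmult polys2_monom) auto
  moreover have "(\<lambda>x. fst x ^ 2 * snd x ^ 0 + fst x ^ 0 * snd x ^ 2 - 1) \<in> polys2 2"
    by (intro polys2_add polys2_diff polys2_monom polys2_const) auto
  ultimately show "(\<lambda>x. fst (quad_map x)) \<in> polys2 2" "(\<lambda>x. snd (quad_map x)) \<in> polys2 2"
    by (simp_all add: quad_map_def split_def mult.assoc)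
qed

lemma polysZ_quad_map:
  assumes f: "f \<in> polysZ m" and "c \<in> polys2 k" "2 * m + int k \<le> int n"
  shows "(\<lambda>x. c x * f (quad_map x)) \<in> polys2 n"
proof (cases "m < 0")
  case True then show ?thesis using assms by (simp add: polysZ_def)
next
  case False
  have "(\<lambda>x. c x * f (fst (quad_map x), snd (quad_map x))) \<in> polys2 (k + nat m * 2)"
    by (intro polys2_mult assms polys2_compose[OF polysZ_subset[OF f] quad_map_polys2])
  moreover have "k + nat m * 2 \<le> n" using False assms by auto
  ultimately show ?thesis using polys2_mono by auto
qed

lemma parity_sum_polys2:
  assumes "f00 \<in> polysZ (int n div 2)" "f01 \<in> polysZ ((int n - 1) div 2)"
     "f10 \<in> polysZ ((int n - 1) div 2)" "f11 \<in> polysZ (int n div 2 - 1)"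
  shows "parity_sum f00 f01 f10 f11 \<in> polys2 n"
proof -
  have s: "(\<lambda>x. fst x + snd x) \<in> polys2 1" "(\<lambda>x. fst x - snd x) \<in> polys2 1"
    using polys2_add polys2_diff polys2_fst[of 0] polys2_snd[of 0] by simp_all
  have q: "(\<lambda>x. (fst x)\<^sup>2 - (snd x)\<^sup>2) \<in> polys2 2"
    using polys2_diff[OF polys2_monom[of 2 0 2] polys2_monom[of 0 2 2]] by simp
  have "(\<lambda>x. 1 * f00 (quad_map x)) \<in> polys2 n"
    by (rule polysZ_quad_map[OF assms(1) polys2_const[of 1 0]]) auto
  then show ?thesis unfolding parity_sum_def
    by (intro polys2_add polysZ_quad_map[OF assms(2) s(1)] polysZ_quad_map[OF assms(3) s(2)]
      polysZ_quad_map[OF assms(4) q]) auto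
qed

section \<open>The maps from the square and the triangle to the parameter domain\<close>

lemma square_compact: "compact square"
  unfolding square_def by (intro compact_Times) auto

lemma square_lebesgue [measurable]: "square \<in> sets lebesgue"
  using square_compact by (simp add: lmeasurable_compact fmeasurableD)

lemma polys2_measurable: "f \<in> polys2 n \<Longrightarrow> f \<in> borel_measurable lebesgue"
  by (intro measurable_completion) (simp add: borel_measurable_continuous_onI continuous_on_polys2)

lemma integrable_polys2_mult:
  assumes g: "integrable lebesgue (\<lambda>x. indicator square x * g x :: real)" and p: "p \<in> polys2 n"
  shows "integrable lebesgue (\<lambda>x. indicator square x * (p x * g x))"
proof -
  have "bounded (p ` square)"
    by (intro compact_imp_bounded compact_continuous_image continuous_on_polys2[OF p] square_compact)
  then obtain M where M: "\<And>x. x \<in> square \<Longrightarrow> \<bar>p x\<bar> \<le> M"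
    by (auto simp: bounded_iff)
  have "integrable lebesgue (\<lambda>x. p x * (indicator square x * g x))"
  proof (rule Bochner_Integration.integrable_bound)
    show "integrable lebesgue (\<lambda>x. M * (indicator square x * g x))" using g by simp
    show "(\<lambda>x. p x * (indicator square x * g x)) \<in> borel_measurable lebesgue"
      using polys2_measurable[OF p] borel_measurable_integrable[OF g] by measurable
    show "AE x in lebesgue. norm (p x * (indicator square x * g x)) \<le> norm (M * (indicator square x * g x))"
    proof (intro always_eventually allI)
      fix x
      show "norm (p x * (indicator square x * g x)) \<le> norm (M * (indicator square x * g x))"
      proof (cases "x \<in> square")
        case True
        then show ?thesis using M[OF True] by (auto simp: abs_mult intro!: mult_right_mono)
      qed simp
    qed
  qed
  then show ?thesis by (simp add: mult.left_commute)
qed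

lemma triangle_open: "open triangle"
proof -
  have *: "triangle = {p. -1 < fst p} \<inter> {p. fst p < snd p} \<inter> {p. snd p < 1}"
    by (auto simp: triangle_def)
  show ?thesis unfolding * by (intro open_Int open_Collect_less continuous_intros)
qed

lemma Omega_open: "open Omega"
proof -
  have *: "Omega = {p. 0 < 1 + fst p + snd p} \<inter> {p. 0 < 1 - fst p + snd p} \<inter> {p. 4 * snd p < (fst p)\<^sup>2} \<inter> {p. \<bar>fst p\<bar> < 2}"
    by (auto simp: Omega_eq)
  show ?thesis unfolding * by (intro open_Int open_Collect_less continuous_intros)
qed

lemma Omega_nonempty: "Omega \<noteq> {}"
proof -
  have "(0, 1/2) \<in> triangle" by (simp add: triangle_def)
  then show ?thesis unfolding Omega_def by blast
qed

lemma AE_interior_off_diagonal: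
  "AE x in lebesgue. \<bar>fst x\<bar> \<noteq> 1 \<and> \<bar>snd x\<bar> \<noteq> 1 \<and> fst x \<noteq> (snd x :: real)"
proof -
  have p: "fst \<in> polys2 1" "snd \<in> polys2 1" using polys2_fst[of 0] polys2_snd[of 0] by simp_all
  have a: "(\<lambda>x. 1 - fst x * fst x) \<in> polys2 (1 + 1)" "(\<lambda>x. 1 - snd x * snd x) \<in> polys2 (1 + 1)"
    "(\<lambda>x. fst x - snd x) \<in> polys2 1"
    by (intro polys2_diff polys2_const polys2_mult p)+
  have "AE x in lebesgue. (1 - fst x * fst x) * (1 - snd x * snd x) * (fst x - snd x) \<noteq> (0 :: real)"
    by (rule polys2_AE_nonzero[OF polys2_mult[OF polys2_mult[OF a(1,2)] a(3)], of 0 "1/2"]) simp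
  then show ?thesis by eventually_elim (auto simp: abs_if split: if_splits)
qed

lemma sym_map_polys2: "(\<lambda>x. fst (sym_map x)) \<in> polys2 2" "(\<lambda>x. snd (sym_map x)) \<in> polys2 2"
proof -
  have p: "fst \<in> polys2 2" "snd \<in> polys2 2" using polys2_fst[of 1] polys2_snd[of 1] by (simp_all add: numeral_2_eq_2)
  have "(\<lambda>x. fst x ^ 1 * snd x ^ 1) \<in> polys2 2" by (intro polys2_monom) auto
  then show "(\<lambda>x. fst (sym_map x)) \<in> polys2 2" "(\<lambda>x. snd (sym_map x)) \<in> polys2 2"
    using polys2_add[OF p] by (simp_all add: sym_map_def split_def)
qed

lemma polys2_sym_map: "p \<in> polys2 n \<Longrightarrow> (\<lambda>x. p (sym_map x)) \<in> polys2 (n * 2)"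
  using polys2_compose[OF _ sym_map_polys2] by simp

lemma polys2_quad_map: "p \<in> polys2 n \<Longrightarrow> (\<lambda>x. p (quad_map x)) \<in> polys2 (n * 2)"
  using polys2_compose[OF _ quad_map_polys2] by simp

lemma polys2_eq_0_if_sym_map:
  assumes "p \<in> polys2 n" "\<And>x. p (sym_map x) = 0"
  shows "p = (\<lambda>x. 0)"
proof
  fix x
  show "p x = 0"
    by (rule polys2_zero_if_zero_on_open[OF assms(1) Omega_open Omega_nonempty])
      (use assms(2) in \<open>auto simp: Omega_def\<close>)
qed

lemma sym_map_change_of_variables:
  fixes f :: "real \<times> real \<Rightarrow> real"
  shows "has_bochner_integral lebesgue (\<lambda>x. indicator triangle x * (\<bar>fst x - snd x\<bar> * f (sym_map x))) i
    \<longleftrightarrow> has_bochner_integral lebesgue (\<lambda>x. indicator Omega x * f x) i"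
proof -
  have "(sym_map has_derivative (\<lambda>h. (1 * fst h + 1 * snd h, snd x * fst h + fst x * snd h))) (at x)" for x
    unfolding sym_map_def split_def
    by (auto intro!: derivative_eq_intros simp: algebra_simps)
  from plane_change_of_variables[of triangle sym_map "\<lambda>x. 1" "\<lambda>x. 1" snd fst f i, OF triangle_open _ this inj_on_sym_map]
  show ?thesis unfolding Omega_def[symmetric] using Omega_open by simp
qed

text \<open>One of the four triangles into which the diagonals divide the open square: the one with
  \<open>x\<^sub>1 + x\<^sub>2\<close> and \<open>x\<^sub>1 - x\<^sub>2\<close> both positive, where they are the positive roots of \<open>1 + u + v\<close> and
  \<open>1 - u + v\<close>.\<close>

definition sector :: "(real \<times> real) set" where
  "sector = {x. \<bar>snd x\<bar> < fst x \<and> fst x < 1}"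

lemma sector_open: "open sector"
proof -
  have *: "sector = {p. \<bar>snd p\<bar> < fst p} \<inter> {p. fst p < 1}"
    by (auto simp: sector_def)
  show ?thesis unfolding * by (intro open_Int open_Collect_less continuous_intros)
qed

lemma quad_map_discriminant:
  "(fst (quad_map x))\<^sup>2 - 4 * snd (quad_map x) = 4 * ((1 - (fst x)\<^sup>2) * (1 - (snd x)\<^sup>2))"
  by (simp add: quad_map_def split_def power2_eq_square algebra_simps)

lemma inj_on_quad_map: "inj_on quad_map sector"
proof (rule inj_onI)
  fix x y assume x: "x \<in> sector" and y: "y \<in> sector" and eq: "quad_map x = quad_map y"
  have "(fst x + snd x)\<^sup>2 = (fst y + snd y)\<^sup>2" "(fst x - snd x)\<^sup>2 = (fst y - snd y)\<^sup>2"
    using eq by (simp_all flip: sum_square_quad_map diff_square_quad_map)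
  then have "fst x + snd x = fst y + snd y" "fst x - snd x = fst y - snd y"
    using x y by (auto simp: sector_def power2_eq_iff_nonneg)
  then show "x = y" by (auto simp: prod_eq_iff)
qed

lemma quad_map_sector: "quad_map ` sector = Omega"
proof (intro equalityI subsetI)
  fix p assume "p \<in> quad_map ` sector"
  then obtain x where x: "x \<in> sector" and p: "p = quad_map x" by blast
  have "(fst x)\<^sup>2 < 1" "(snd x)\<^sup>2 < 1" using x by (auto simp: sector_def abs_square_less_1)
  then have d: "0 < (fst (quad_map x))\<^sup>2 - 4 * snd (quad_map x)" unfolding quad_map_discriminant by simp
  have s: "0 < 1 + fst (quad_map x) + snd (quad_map x)" "0 < 1 - fst (quad_map x) + snd (quad_map x)"
    unfolding sum_square_quad_map diff_square_quad_map using x by (auto simp: sector_def)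
  have "\<bar>fst x\<bar> * \<bar>snd x\<bar> < 1 * 1"
    using x by (intro mult_strict_mono') (auto simp: sector_def)
  then have "\<bar>fst (quad_map x)\<bar> < 2" by (simp add: quad_map_def split_def abs_mult)
  then show "p \<in> Omega" using d s unfolding Omega_eq p by (simp add: split_def)
next
  fix p assume "p \<in> Omega"
  then obtain u v where p: "p = (u, v)" and h: "1 + u + v > 0" "1 - u + v > 0" "u\<^sup>2 > 4 * v" "\<bar>u\<bar> < 2"
    unfolding Omega_eq by auto
  define a b where "a = sqrt (1 + u + v)" and "b = sqrt (1 - u + v)"
  have ab: "a > 0" "b > 0" "a\<^sup>2 = 1 + u + v" "b\<^sup>2 = 1 - u + v" using h by (auto simp: a_def b_def)
  define x where "x = ((a + b) / 2, (a - b) / 2)"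
  have q: "quad_map x = p"
    using ab(3,4) by (simp add: x_def quad_map_def p power2_eq_square field_simps)
  have lt: "\<bar>snd x\<bar> < fst x" using ab by (auto simp: x_def abs_if field_simps)
  have "0 < (fst (quad_map x))\<^sup>2 - 4 * snd (quad_map x)" using h by (simp add: q p)
  then have d: "0 < (1 - (fst x)\<^sup>2) * (1 - (snd x)\<^sup>2)" unfolding quad_map_discriminant by linarith
  have u: "\<bar>fst x * snd x\<bar> < 1"
  proof -
    have "u = 2 * (fst x * snd x)" using q by (simp add: p quad_map_def split_def)
    then have "\<bar>u\<bar> = 2 * \<bar>fst x * snd x\<bar>" by (simp add: abs_mult)
    then show ?thesis using h(4) by linarith
  qed
  have "fst x < 1"
  proof (rule ccontr)
    \<comment> \<open>Positivity of \<open>(1 - x\<^sub>1\<^sup>2) (1 - x\<^sub>2\<^sup>2)\<close> would force \<open>|x\<^sub>2|\<close> above \<open>1\<close> as well, against \<open>|x\<^sub>1 x\<^sub>2| < 1\<close>.\<close>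
    assume "\<not> fst x < 1"
    then have f: "fst x \<ge> 1" by simp
    then have "1 - (fst x)\<^sup>2 \<le> 0" by simp
    with d have "1 - (snd x)\<^sup>2 < 0" by (simp add: zero_less_mult_iff)
    then have "1 < \<bar>snd x\<bar>" by (simp add: abs_square_le_1 flip: not_le)
    then have "1 * 1 \<le> \<bar>fst x\<bar> * \<bar>snd x\<bar>" using f by (intro mult_mono) auto
    then show False using u by (simp add: abs_mult)
  qed
  then have "x \<in> sector" using lt by (simp add: sector_def)
  then show "p \<in> quad_map ` sector" using q by blast
qed

lemma quad_map_change_of_variables:
  fixes f :: "real \<times> real \<Rightarrow> real"
  shows "has_bochner_integral lebesgue (\<lambda>x. indicator sector x * (4 * \<bar>(fst x)\<^sup>2 - (snd x)\<^sup>2\<bar> * f (quad_map x))) i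
    \<longleftrightarrow> has_bochner_integral lebesgue (\<lambda>x. indicator Omega x * f x) i"
proof -
  have J: "\<bar>2 * snd x * (2 * snd x) - 2 * fst x * (2 * fst x)\<bar> = 4 * \<bar>(fst x)\<^sup>2 - (snd x)\<^sup>2\<bar>" for x :: "real \<times> real"
  proof -
    have "2 * snd x * (2 * snd x) - 2 * fst x * (2 * fst x) = (-4) * ((fst x)\<^sup>2 - (snd x)\<^sup>2)"
      by (simp add: power2_eq_square algebra_simps)
    then show ?thesis by (simp only: abs_mult)
  qed
  have "(quad_map has_derivative (\<lambda>h. (2 * snd x * fst h + 2 * fst x * snd h, 2 * fst x * fst h + 2 * snd x * snd h))) (at x)" for x
    unfolding quad_map_def split_def
    by (auto intro!: derivative_eq_intros simp: algebra_simps)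
  from plane_change_of_variables[of sector quad_map "\<lambda>x. 2 * snd x" "\<lambda>x. 2 * fst x" "\<lambda>x. 2 * fst x" "\<lambda>x. 2 * snd x" f i, OF sector_open _ this inj_on_quad_map]
  show ?thesis unfolding quad_map_sector J using Omega_open by simp
qed

lemma square_weight_uminus: "square_weight w \<gamma> (- x) = square_weight w \<gamma> x"
  and square_weight_swap: "square_weight w \<gamma> (prod.swap x) = square_weight w \<gamma> x"
  by (simp_all add: square_weight_def quad_map_def split_def algebra_simps abs_minus_commute)

lemma quad_map_uminus: "quad_map (- x) = quad_map x"
  and quad_map_swap: "quad_map (prod.swap x) = quad_map x"
  by (simp_all add: quad_map_def split_def algebra_simps)

lemma square_uminus: "- x \<in> square \<longleftrightarrow> x \<in> square"
  and square_swap: "prod.swap x \<in> square \<longleftrightarrow> x \<in> square"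
  unfolding square_def mem_Times_iff by auto

text \<open>On the boundary of the square \<open>u\<^sup>2 - 4 v = 0\<close>, and \<open>0 powr \<gamma> = 0\<close> whatever value \<open>W_weight\<close>
  takes for \<open>\<sigma>\<close> and \<open>\<tau>\<close> there; on the diagonals the factor \<open>|x\<^sub>1\<^sup>2 - x\<^sub>2\<^sup>2|\<close> vanishes. Hence the
  decomposition of the square into sectors holds pointwise after multiplication by the weight.\<close>

lemma square_weight_eq_0:
  assumes "\<bar>fst x\<bar> = 1 \<or> \<bar>snd x\<bar> = 1 \<or> \<bar>fst x\<bar> = \<bar>snd x\<bar>"
  shows "square_weight w \<gamma> x = 0"
proof -
  have "\<bar>fst x\<bar> = 1 \<or> \<bar>snd x\<bar> = 1 \<Longrightarrow> (fst (quad_map x))\<^sup>2 - 4 * snd (quad_map x) = 0"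
    unfolding quad_map_discriminant using abs_square_eq_1 by auto
  moreover have "\<bar>fst x\<bar> = \<bar>snd x\<bar> \<Longrightarrow> (fst x)\<^sup>2 = (snd x)\<^sup>2" by (metis power2_abs)
  ultimately show ?thesis
    using assms by (auto simp: square_weight_def W_weight_def split_def)
qed

lemma square_decomposition:
  assumes "\<bar>fst x\<bar> \<noteq> 1" "\<bar>snd x\<bar> \<noteq> 1" "\<bar>fst x\<bar> \<noteq> \<bar>snd x\<bar>"
  shows "(indicator square x :: real) = indicator sector x + indicator sector (- x) +
    indicator sector (prod.swap x) + indicator sector (prod.swap (- x))"
proof (cases x)
  case (Pair a b)
  show ?thesis using assms unfolding Pair
    by (auto simp: indicator_def square_def sector_def abs_if split: if_splits)
qed

text \<open>The factor \<open>4\<close> of the Jacobian of \<open>quad_map\<close> on one sector is compensated by the number of sectors.\<close>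

lemma square_integral_even:
  assumes "has_bochner_integral lebesgue (\<lambda>x. indicator Omega x * (g x * W_weight w \<gamma> x)) i"
  shows "has_bochner_integral lebesgue (\<lambda>x. indicator square x * (g (quad_map x) * square_weight w \<gamma> x)) i"
proof -
  define G where "G x = indicator sector x * (g (quad_map x) * square_weight w \<gamma> x)" for x
  have "has_bochner_integral lebesgue (\<lambda>x. indicator sector x * (4 * \<bar>(fst x)\<^sup>2 - (snd x)\<^sup>2\<bar> *
     (g (quad_map x) * W_weight w \<gamma> (quad_map x)))) i"
    using assms quad_map_change_of_variables[of "\<lambda>x. g x * W_weight w \<gamma> x" i] by blast
  from has_bochner_integral_mult_right[OF this, of "1/4"]
  have G: "has_bochner_integral lebesgue G (i / 4)"
    unfolding G_def[abs_def] square_weight_def split_def by (simp add: mult_ac)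
  note u = has_bochner_integral_plane_uminus and s = has_bochner_integral_plane_swap
  have "has_bochner_integral lebesgue (\<lambda>x. G x + G (- x) + (G (prod.swap x) + G (prod.swap (- x)))) (i/4 + i/4 + (i/4 + i/4))"
    by (intro has_bochner_integral_add G u s u[where f = "\<lambda>x. G (prod.swap x)"])
  also have "(\<lambda>x. G x + G (- x) + (G (prod.swap x) + G (prod.swap (- x)))) =
     (\<lambda>x. indicator square x * (g (quad_map x) * square_weight w \<gamma> x))"
  proof
    fix x
    have "G x + G (- x) + (G (prod.swap x) + G (prod.swap (- x))) =
      (indicator sector x + indicator sector (- x) + indicator sector (prod.swap x) + indicator sector (prod.swap (- x)))
      * (g (quad_map x) * square_weight w \<gamma> x)"
      by (simp add: G_def square_weight_uminus square_weight_swap quad_map_uminus quad_map_swap distrib_right del: swap_simp)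
    also have "\<dots> = indicator square x * (g (quad_map x) * square_weight w \<gamma> x)"
      using square_decomposition[of x] square_weight_eq_0[of x w \<gamma>] by force
    finally show "G x + G (- x) + (G (prod.swap x) + G (prod.swap (- x))) = indicator square x * (g (quad_map x) * square_weight w \<gamma> x)" .
  qed
  finally show ?thesis by simp
qed

text \<open>Substituting the reflection under which \<open>h\<close> changes sign shows that the integral equals its
  negative.\<close>

lemma square_integral_odd:
  fixes h :: "real \<times> real \<Rightarrow> real"
  assumes int: "integrable lebesgue (\<lambda>x. indicator square x * square_weight w \<gamma> x)"
    and h: "h \<in> polys2 n"
    and odd: "(\<forall>x. h (- x) = - h x) \<or> (\<forall>x. h (prod.swap x) = - h x)"
  shows "has_bochner_integral lebesgue (\<lambda>x. indicator square x * (h x * square_weight w \<gamma> x)) 0"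
proof -
  define H where "H x = indicator square x * (h x * square_weight w \<gamma> x)" for x
  define i where "i = integral\<^sup>L lebesgue H"
  have H: "has_bochner_integral lebesgue H i"
    unfolding H_def[abs_def] i_def by (intro has_bochner_integral_integrable integrable_polys2_mult[OF int h])
  have "has_bochner_integral lebesgue (\<lambda>x. H (- x)) i" "has_bochner_integral lebesgue (\<lambda>x. H (prod.swap x)) i"
    by (rule has_bochner_integral_plane_uminus[OF H] has_bochner_integral_plane_swap[OF H])+
  moreover have "(\<lambda>x. H (- x)) = (\<lambda>x. - H x) \<or> (\<lambda>x. H (prod.swap x)) = (\<lambda>x. - H x)"
    using odd
  proof
    assume "\<forall>x. h (- x) = - h x"
    then have "H (- x) = - H x" for x
      by (simp only: H_def indicator_def square_uminus square_weight_uminus)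
    then show ?thesis by blast
  next
    assume "\<forall>x. h (prod.swap x) = - h x"
    then have "H (prod.swap x) = - H x" for x
      by (simp only: H_def indicator_def square_swap square_weight_swap)
    then show ?thesis by blast
  qed
  ultimately have "has_bochner_integral lebesgue (\<lambda>x. - H x) i" by metis
  moreover have "has_bochner_integral lebesgue (\<lambda>x. - H x) (- i)" by (intro has_bochner_integral_minus H)
  ultimately have "i = - i" by (rule has_bochner_integral_eq)
  then have "i = 0" by simp
  then show ?thesis using H unfolding H_def[abs_def] by simp
qed

section \<open>Symmetrized weights\<close>

lemma sym_map_factors:
  "1 - fst (sym_map x) + snd (sym_map x) = (1 - fst x) * (1 - snd x)"
  "1 + fst (sym_map x) + snd (sym_map x) = (1 + fst x) * (1 + snd x)"
  by (simp_all add: sym_map_def split_def algebra_simps)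

lemma Omega_lebesgue_on_iff:
  "has_bochner_integral (lebesgue_on Omega) f i \<longleftrightarrow> has_bochner_integral lebesgue (\<lambda>x. indicator Omega x * f x) (i :: real)"
  using Omega_open by (subst has_bochner_integral_restrict_space) (auto simp: borel_open)

lemma square_lebesgue_on_iff:
  "has_bochner_integral (lebesgue_on square) f i \<longleftrightarrow> has_bochner_integral lebesgue (\<lambda>x. indicator square x * f x) (i :: real)"
  by (subst has_bochner_integral_restrict_space) auto

text \<open>All integrals below reduce to integrals of polynomials against \<open>weight_integrand w \<gamma>\<close>. The
  assumptions say that this is the density of a finite nonzero measure on the square.\<close>

locale admissible_weight =
  fixes w :: "real \<Rightarrow> real" and \<gamma> :: real
  assumes nonneg: "\<And>x. x \<in> {-1..1} \<Longrightarrow> w x \<ge> 0"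
    and integrable_wi: "set_integrable lebesgue square (weight_integrand w \<gamma>)"
    and pos: "(LINT p:square|lebesgue. weight_integrand w \<gamma> p) > 0"
begin

abbreviation wi where "wi \<equiv> weight_integrand w \<gamma>"

lemma wi_nonneg: "x \<in> square \<Longrightarrow> 0 \<le> wi x"
  using nonneg by (cases x) (auto simp: weight_integrand_def square_def)

lemma integrable_polys2_wi:
  assumes "p \<in> polys2 n"
  shows "integrable lebesgue (\<lambda>x. indicator square x * (p x * wi x))"
  using integrable_polys2_mult[OF _ assms, of wi] integrable_wi by (simp add: set_integrable_def)

text \<open>The zeros of \<open>p\<close> form a null set, so a zero integral would force \<open>weight_integrand w \<gamma>\<close> to vanish
  almost everywhere on the square.\<close>

lemma integral_polys2_wi_pos:
  assumes p: "p \<in> polys2 n" and nn: "\<And>x. x \<in> square \<Longrightarrow> 0 \<le> p x" and nz: "p x0 \<noteq> 0"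
  shows "0 < (LINT x|lebesgue. indicator square x * (p x * wi x))"
proof -
  have nn': "AE x in lebesgue. 0 \<le> indicator square x * (p x * wi x)"
    using nn wi_nonneg by (intro always_eventually) (simp add: indicator_def)
  have "(LINT x|lebesgue. indicator square x * (p x * wi x)) \<noteq> 0"
  proof
    assume "(LINT x|lebesgue. indicator square x * (p x * wi x)) = 0"
    then have "AE x in lebesgue. indicator square x * (p x * wi x) = 0"
      using integral_nonneg_eq_0_iff_AE[OF integrable_polys2_wi[OF p] nn'] by simp
    moreover have "AE x in lebesgue. p x \<noteq> 0" using polys2_AE_nonzero[OF p, of "fst x0" "snd x0"] nz by simp
    ultimately have "AE x in lebesgue. indicator square x *\<^sub>R wi x = 0"
      by eventually_elim auto
    then have "(LINT p:square|lebesgue. wi p) = 0"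
      unfolding set_lebesgue_integral_def by (rule integral_eq_zero_AE)
    then show False using pos by simp
  qed
  moreover have "0 \<le> (LINT x|lebesgue. indicator square x * (p x * wi x))"
    by (rule integral_nonneg_AE[OF nn'])
  ultimately show ?thesis by simp
qed

lemma norm_const_pos: "0 < norm_const w \<gamma>"
  using pos by (simp add: norm_const_def)

lemma mod_weight_polys2:
  "(\<lambda>x. (1 - fst x + snd x) ^ i * (1 + fst x + snd x) ^ j) \<in> polys2 (i * 1 + j * 1)"
  by (intro polys2_mult polys2_power affine_polys2)

lemma weight_integrand_mod_weight:
  "weight_integrand (mod_weight i j w) \<gamma> x =
    (1 - fst (sym_map x) + snd (sym_map x)) ^ i * (1 + fst (sym_map x) + snd (sym_map x)) ^ j * wi x"
  unfolding sym_map_factors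
  by (simp add: weight_integrand_def split_def mod_weight_def power_mult_distrib mult_ac)

lemma mod_factor_nonneg:
  assumes "x \<in> square"
  shows "0 \<le> (1 - fst (sym_map x) + snd (sym_map x)) ^ i * (1 + fst (sym_map x) + snd (sym_map x)) ^ j"
  using assms unfolding sym_map_factors by (auto simp: square_def)

text \<open>Multiplying \<open>w\<close> by \<open>(1 - x)\<^sup>i (1 + x)\<^sup>j\<close> multiplies \<open>weight_integrand w \<gamma>\<close> by a polynomial that is
  nonnegative on the square and not identically zero, so the integral defining the new normalization stays positive. Were it zero,
  the modified weight would vanish identically and have no kernel.\<close>

lemma d_const_pos: "0 < d_const i j w \<gamma>"
proof -
  have "0 < (LINT x|lebesgue. indicator square x *
     ((1 - fst (sym_map x) + snd (sym_map x)) ^ i * (1 + fst (sym_map x) + snd (sym_map x)) ^ j * wi x))"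
    by (rule integral_polys2_wi_pos[OF polys2_sym_map[OF mod_weight_polys2], of i j "(0, 0)"])
      (simp add: mod_factor_nonneg, simp add: sym_map_def)
  then have "0 < (LINT p:square|lebesgue. weight_integrand (mod_weight i j w) \<gamma> p)"
    by (simp add: set_lebesgue_integral_def weight_integrand_mod_weight)
  then show ?thesis using norm_const_pos by (simp add: d_const_def norm_const_def[of "mod_weight i j w"])
qed

lemma W_mod_weight_0_0: "W_mod_weight 0 0 w \<gamma> = W_weight w \<gamma>"
proof -
  have "mod_weight 0 0 w = w" by (simp add: mod_weight_def)
  then have "d_const 0 0 w \<gamma> = 1" using norm_const_pos by (simp only: d_const_def) simp
  then show ?thesis by (simp add: W_mod_weight_def)
qed

lemma W_weight_triangle:
  assumes "x \<in> triangle"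
  shows "\<bar>fst x - snd x\<bar> * W_weight w \<gamma> (sym_map x) = 2 * norm_const w \<gamma> * wi x"
proof -
  obtain a b where x: "x = (a, b)" and ab: "-1 < a" "a < b" "b < 1" using assms by (auto simp: triangle_def)
  have "(a + b)\<^sup>2 - 4 * (a * b) = (b - a) powr 2"
    using ab by (simp add: powr_numeral power2_eq_square algebra_simps)
  then have "((a + b)\<^sup>2 - 4 * (a * b)) powr \<gamma> = (b - a) powr (2 * \<gamma>)"
    by (simp only: powr_powr)
  moreover have "(b - a) * (b - a) powr (2 * \<gamma>) = (b - a) powr (2 * \<gamma> + 1)"
    using ab by (simp add: powr_add mult.commute)
  moreover have "\<bar>a - b\<bar> = b - a" using ab by simp
  ultimately show ?thesis
    using W_weight_sym_map[OF ab, of w \<gamma>] by (simp add: x sym_map_def weight_integrand_def mult_ac)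
qed

text \<open>Under \<open>sym_map\<close> the integral over \<open>Omega\<close> becomes one over the triangle \<open>\<sigma> < \<tau>\<close>. The integrand is
  symmetric in \<open>\<sigma>\<close> and \<open>\<tau>\<close>, so this is half the integral over the square, which cancels the \<open>2\<close> in the
  definition of \<open>W_weight\<close>.\<close>

lemma Omega_integral:
  assumes p: "p \<in> polys2 n"
  shows "has_bochner_integral lebesgue (\<lambda>x. indicator Omega x * (p x * W_weight w \<gamma> x))
    (norm_const w \<gamma> * (LINT x|lebesgue. indicator square x * (p (sym_map x) * wi x)))"
proof -
  define H where "H x = indicator square x * (p (sym_map x) * wi x)" for x
  \<comment> \<open>The part of the symmetric function \<open>H\<close> above the diagonal; almost everywhere \<open>H\<close> is the sum of \<open>F\<close> and its mirror image.\<close>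
  define F where "F x = indicator triangle x * H x" for x
  define J where "J = integral\<^sup>L lebesgue F"
  have H: "integrable lebesgue H"
    unfolding H_def[abs_def] by (rule integrable_polys2_wi[OF polys2_sym_map[OF p]])
  have "integrable lebesgue F"
    unfolding F_def[abs_def] using integrable_mult_indicator[OF _ H, of triangle] triangle_open
    by (simp add: borel_open)
  then have F: "has_bochner_integral lebesgue F J" unfolding J_def by (rule has_bochner_integral_integrable)
  from has_bochner_integral_add[OF F has_bochner_integral_plane_swap[OF F]]
  have FF: "has_bochner_integral lebesgue (\<lambda>x. F x + F (prod.swap x)) (J + J)" .
  have "AE x in lebesgue. H x = F x + F (prod.swap x)"
    using AE_interior_off_diagonal
  proof eventually_elim
    case (elim x)
    obtain a b where x: "x = (a, b)" by fastforce
    have sw: "H (prod.swap x) = H x"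
    proof -
      have "sym_map (prod.swap x) = sym_map x" "wi (prod.swap x) = wi x"
        by (simp_all add: x sym_map_def weight_integrand_def abs_minus_commute mult_ac add.commute)
      then show ?thesis by (simp only: H_def indicator_def square_swap)
    qed
    have "indicator square x = (indicator triangle x + indicator triangle (prod.swap x) :: real)"
      using elim by (auto simp: x square_def triangle_def indicator_def abs_if split: if_splits)
    moreover have "H x = indicator square x * H x" by (simp add: H_def indicator_def)
    ultimately have "H x = (indicator triangle x + indicator triangle (prod.swap x)) * H x" by metis
    then show ?case by (simp add: F_def sw distrib_right del: swap_simp)
  qed
  then have "integral\<^sup>L lebesgue H = (LINT x|lebesgue. F x + F (prod.swap x))"
    using H FF by (intro integral_cong_AE borel_measurable_integrable) (auto simp only: has_bochner_integral_iff)
  then have "integral\<^sup>L lebesgue H = J + J" by (simp only: has_bochner_integral_integral_eq[OF FF])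
  then have "norm_const w \<gamma> * integral\<^sup>L lebesgue H = 2 * norm_const w \<gamma> * J" by simp
  moreover have "has_bochner_integral lebesgue (\<lambda>x. 2 * norm_const w \<gamma> * F x) (2 * norm_const w \<gamma> * J)"
    by (rule has_bochner_integral_mult_right) (rule F)
  moreover have "2 * norm_const w \<gamma> * F x = indicator triangle x * (\<bar>fst x - snd x\<bar> * (p (sym_map x) * W_weight w \<gamma> (sym_map x)))" for x
  proof (cases "x \<in> triangle")
    case True
    then have "x \<in> square" by (auto simp: triangle_def square_def)
    then show ?thesis using True W_weight_triangle[OF True] by (simp add: F_def H_def mult.left_commute)
  qed (simp add: F_def)
  ultimately show ?thesis
    using sym_map_change_of_variables[of "\<lambda>x. p x * W_weight w \<gamma> x" "2 * norm_const w \<gamma> * J"]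
    unfolding H_def[symmetric] by (simp only:)
qed

text \<open>Up to a positive factor \<open>i\<close> is the integral of \<open>p \<circ> sym_map\<close> against \<open>weight_integrand w \<gamma>\<close> over the
  square. If it is zero then so is \<open>p \<circ> sym_map\<close>; thus \<open>p\<close> vanishes on the open set \<open>Omega\<close>, hence
  everywhere.\<close>

lemma Omega_positive:
  assumes p: "p \<in> polys2 n" and nn: "\<And>x. x \<in> square \<Longrightarrow> 0 \<le> p (sym_map x)"
    and i: "has_bochner_integral (lebesgue_on Omega) (\<lambda>x. p x * W_weight w \<gamma> x) i"
  shows "0 \<le> i" and "i = 0 \<Longrightarrow> p = (\<lambda>x. 0)"
proof -
  have i_eq: "i = norm_const w \<gamma> * (LINT x|lebesgue. indicator square x * (p (sym_map x) * wi x))"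
    using i Omega_integral[OF p] unfolding Omega_lebesgue_on_iff by (rule has_bochner_integral_eq)
  have "0 \<le> (LINT x|lebesgue. indicator square x * (p (sym_map x) * wi x))"
    using nn wi_nonneg by (intro integral_nonneg_AE always_eventually) (simp add: indicator_def)
  then show "0 \<le> i" using norm_const_pos by (simp add: i_eq)
  show "p = (\<lambda>x. 0)" if "i = 0"
  proof (rule polys2_eq_0_if_sym_map[OF p], rule ccontr)
    fix x assume "p (sym_map x) \<noteq> 0"
    from integral_polys2_wi_pos[OF polys2_sym_map[OF p] nn this] norm_const_pos have "0 < i"
      unfolding i_eq by simp
    then show False using that by simp
  qed
qed

text \<open>The integral of \<open>f\<^sup>2\<close> against the modified weight is a positive multiple of the integral of the
  polynomial \<open>f\<^sup>2 (1 - u + v)\<^sup>i (1 + u + v)\<^sup>j\<close> against \<open>W_weight w \<gamma>\<close>. The two affine factors are positive on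
  \<open>Omega\<close>, so \<open>f\<close> vanishes when this polynomial does.\<close>

lemma definite_W_mod_weight: "definite_weight Omega (W_mod_weight i j w \<gamma>)"
  unfolding definite_weight_def
proof (intro allI ballI)
  fix n f assume f: "f \<in> polys2 n"
  define q where "q = (\<lambda>x :: real \<times> real. (1 - fst x + snd x) ^ i * (1 + fst x + snd x) ^ j)"
  have q: "q \<in> polys2 (i * 1 + j * 1)" unfolding q_def by (rule mod_weight_polys2)
  define d where "d = d_const i j w \<gamma>"
  have d: "0 < d" unfolding d_def by (rule d_const_pos)
  have W: "W_mod_weight i j w \<gamma> x = d * (q x * W_weight w \<gamma> x)" for x
    by (simp add: W_mod_weight_def q_def d_def split_def mult_ac)
  have int: "integrable (lebesgue_on Omega) (\<lambda>x. p x * W_weight w \<gamma> x)" if "p \<in> polys2 m" for p m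
    using Omega_integral[OF that] unfolding Omega_lebesgue_on_iff[symmetric] by (simp add: has_bochner_integral_iff)
  have "integrable (lebesgue_on Omega) (\<lambda>x. d * (f x * q x * W_weight w \<gamma> x))"
    using int[OF polys2_mult[OF f q]] by simp
  then have 1: "integrable (lebesgue_on Omega) (\<lambda>x. f x * W_mod_weight i j w \<gamma> x)"
    by (simp add: W mult_ac)
  define p where "p = (\<lambda>x. f x * f x * q x)"
  have p: "p \<in> polys2 (n + n + (i * 1 + j * 1))" unfolding p_def by (intro polys2_mult f q)
  define I where "I = (LINT x|lebesgue_on Omega. p x * W_weight w \<gamma> x)"
  have I: "has_bochner_integral (lebesgue_on Omega) (\<lambda>x. p x * W_weight w \<gamma> x) I"
    unfolding I_def by (intro has_bochner_integral_integrable int[OF p])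
  have pnn: "0 \<le> p (sym_map x)" if "x \<in> square" for x
    using mod_factor_nonneg[OF that] by (simp add: p_def q_def)
  have "(\<lambda>x. f x * f x * W_mod_weight i j w \<gamma> x) = (\<lambda>x. d * (p x * W_weight w \<gamma> x))"
    by (auto simp: W p_def mult_ac)
  then have eq: "(LINT x|lebesgue_on Omega. f x * f x * W_mod_weight i j w \<gamma> x) = d * I"
    by (simp add: I_def)
  have 2: "0 \<le> d * I" using Omega_positive(1)[OF p pnn I] d by simp
  have 3: "f = (\<lambda>x. 0)" if "d * I = 0"
  proof (rule polys2_eq_0_if_sym_map[OF f])
    have p0: "p = (\<lambda>x. 0)" using Omega_positive(2)[OF p pnn I] that d by simp
    have "f x = 0" if "x \<in> Omega" for x
    proof -
      have "0 < q x" using that by (auto simp: q_def Omega_eq)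
      then show ?thesis using fun_cong[OF p0, of x] by (simp add: p_def)
    qed
    then show "f (sym_map x) = 0" for x
      using polys2_zero_if_zero_on_open[OF f Omega_open Omega_nonempty] by blast
  qed
  show "integrable (lebesgue_on Omega) (\<lambda>x. f x * W_mod_weight i j w \<gamma> x) \<and>
    0 \<le> (LINT x|lebesgue_on Omega. f x * f x * W_mod_weight i j w \<gamma> x) \<and>
    ((LINT x|lebesgue_on Omega. f x * f x * W_mod_weight i j w \<gamma> x) = 0 \<longrightarrow> f = (\<lambda>x. 0))"
    unfolding eq using 1 2 3 by blast
qed

lemma parity_sum_integral:
  assumes g: "g00 \<in> polys2 n" "g01 \<in> polys2 n" "g10 \<in> polys2 n" "g11 \<in> polys2 n"
    and i: "has_bochner_integral (lebesgue_on Omega) (\<lambda>x. g00 x * W_weight w \<gamma> x) i"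
  shows "has_bochner_integral (lebesgue_on square) (\<lambda>x. parity_sum g00 g01 g10 g11 x * square_weight w \<gamma> x) i"
proof -
  have "has_bochner_integral lebesgue (\<lambda>x. indicator square x * (1 * square_weight w \<gamma> x))
     (norm_const w \<gamma> * (LINT x|lebesgue. indicator square x * (1 * wi x)))"
    by (rule square_integral_even) (rule Omega_integral[OF polys2_const[of 1 0]])
  then have int: "integrable lebesgue (\<lambda>x. indicator square x * square_weight w \<gamma> x)"
    by (simp add: has_bochner_integral_iff)
  have s: "(\<lambda>x. fst x + snd x) \<in> polys2 1" "(\<lambda>x. fst x - snd x) \<in> polys2 1"
    using polys2_add polys2_diff polys2_fst[of 0] polys2_snd[of 0] by simp_all
  have q: "(\<lambda>x. (fst x)\<^sup>2 - (snd x)\<^sup>2) \<in> polys2 2"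
    using polys2_diff[OF polys2_monom[of 2 0 2] polys2_monom[of 0 2 2]] by simp
  note odd = square_integral_odd[OF int]
  have 0: "has_bochner_integral lebesgue (\<lambda>x. indicator square x * (g00 (quad_map x) * square_weight w \<gamma> x)) i"
    by (rule square_integral_even[OF i[unfolded Omega_lebesgue_on_iff]])
  have 1: "has_bochner_integral lebesgue (\<lambda>x. indicator square x * ((fst x + snd x) * g01 (quad_map x) * square_weight w \<gamma> x)) 0"
    by (rule odd[OF polys2_mult[OF s(1) polys2_quad_map[OF g(2)]]])
      (simp add: quad_map_uminus algebra_simps del: split_paired_All)
  have 2: "has_bochner_integral lebesgue (\<lambda>x. indicator square x * ((fst x - snd x) * g10 (quad_map x) * square_weight w \<gamma> x)) 0"
    by (rule odd[OF polys2_mult[OF s(2) polys2_quad_map[OF g(3)]]])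
      (simp add: quad_map_uminus algebra_simps del: split_paired_All)
  have 3: "has_bochner_integral lebesgue (\<lambda>x. indicator square x * (((fst x)\<^sup>2 - (snd x)\<^sup>2) * g11 (quad_map x) * square_weight w \<gamma> x)) 0"
    by (rule odd[OF polys2_mult[OF q polys2_quad_map[OF g(4)]]])
      (simp add: quad_map_swap algebra_simps del: split_paired_All swap_simp)
  from has_bochner_integral_add[OF has_bochner_integral_add[OF has_bochner_integral_add[OF 0 1] 2] 3]
  show ?thesis unfolding square_lebesgue_on_iff
    by (simp add: parity_sum_def algebra_simps)
qed

lemma parity_sum_mult:
  "parity_sum f00 f01 f10 f11 x * parity_sum g00 g01 g10 g11 x = parity_sum
     (\<lambda>p. f00 p * g00 p + (1 + fst p + snd p) * (f01 p * g01 p) + (1 - fst p + snd p) * (f10 p * g10 p)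
        + (1 + fst p + snd p) * (1 - fst p + snd p) * (f11 p * g11 p))
     (\<lambda>p. f00 p * g01 p + f01 p * g00 p + (1 - fst p + snd p) * (f10 p * g11 p + f11 p * g10 p))
     (\<lambda>p. f00 p * g10 p + f10 p * g00 p + (1 + fst p + snd p) * (f01 p * g11 p + f11 p * g01 p))
     (\<lambda>p. f00 p * g11 p + f11 p * g00 p + f01 p * g10 p + f10 p * g01 p) x"
proof -
  have expand: "(a + A * b + B * c + A * B * d) * (a' + A * b' + B * c' + A * B * d') =
      a * a' + A\<^sup>2 * (b * b') + B\<^sup>2 * (c * c') + A\<^sup>2 * B\<^sup>2 * (d * d')
    + A * (a * b' + b * a' + B\<^sup>2 * (c * d' + d * c'))
    + B * (a * c' + c * a' + A\<^sup>2 * (b * d' + d * b'))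
    + A * B * (a * d' + d * a' + b * c' + c * b')" for A B a b c d a' b' c' d' :: real
    by (simp add: power2_eq_square algebra_simps)
  have "(fst x)\<^sup>2 - (snd x)\<^sup>2 = (fst x + snd x) * (fst x - snd x)"
    by (simp add: power2_eq_square algebra_simps)
  then show ?thesis
    unfolding parity_sum_def sum_square_quad_map diff_square_quad_map by (simp only: expand)
qed

lemma parity_product_polys2:
  assumes f: "f00 \<in> polys2 n" "f01 \<in> polys2 n" "f10 \<in> polys2 n" "f11 \<in> polys2 n"
    and g: "g00 \<in> polys2 n" "g01 \<in> polys2 n" "g10 \<in> polys2 n" "g11 \<in> polys2 n"
  shows "(\<lambda>p. f00 p * g00 p + (1 + fst p + snd p) * (f01 p * g01 p) + (1 - fst p + snd p) * (f10 p * g10 p)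
        + (1 + fst p + snd p) * (1 - fst p + snd p) * (f11 p * g11 p)) \<in> polys2 (2 * n + 2)"
   and "(\<lambda>p. f00 p * g01 p + f01 p * g00 p + (1 - fst p + snd p) * (f10 p * g11 p + f11 p * g10 p)) \<in> polys2 (2 * n + 2)"
   and "(\<lambda>p. f00 p * g10 p + f10 p * g00 p + (1 + fst p + snd p) * (f01 p * g11 p + f11 p * g01 p)) \<in> polys2 (2 * n + 2)"
   and "(\<lambda>p. f00 p * g11 p + f11 p * g00 p + f01 p * g10 p + f10 p * g01 p) \<in> polys2 (2 * n + 2)"
proof -
  have m: "(\<lambda>p. u p * v p) \<in> polys2 (2 * n)" if "u \<in> polys2 n" "v \<in> polys2 n" for u v
    using polys2_mult[OF that] by (simp add: mult_2)
  have up: "u \<in> polys2 (2 * n + 2)" if "u \<in> polys2 (2 * n)" for u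
    using that by (rule polys2_mono) simp
  have l: "(\<lambda>p. (1 + fst p + snd p) * u p) \<in> polys2 (2 * n + 2)"
    "(\<lambda>p. (1 - fst p + snd p) * u p) \<in> polys2 (2 * n + 2)" 
    "(\<lambda>p. (1 + fst p + snd p) * (1 - fst p + snd p) * u p) \<in> polys2 (2 * n + 2)" if u: "u \<in> polys2 (2 * n)" for u
    by (rule polys2_mono[OF polys2_mult[OF affine_polys2(1) u]] polys2_mono[OF polys2_mult[OF affine_polys2(2) u]]
      polys2_mono[OF polys2_mult[OF polys2_mult[OF affine_polys2] u]]; simp)+
  note add = polys2_add
  show "(\<lambda>p. f00 p * g00 p + (1 + fst p + snd p) * (f01 p * g01 p) + (1 - fst p + snd p) * (f10 p * g10 p)
        + (1 + fst p + snd p) * (1 - fst p + snd p) * (f11 p * g11 p)) \<in> polys2 (2 * n + 2)"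
    by (rule add[OF add[OF add[OF up[OF m[OF f(1) g(1)]] l(1)[OF m[OF f(2) g(2)]]] l(2)[OF m[OF f(3) g(3)]]]
      l(3)[OF m[OF f(4) g(4)]]])
  show "(\<lambda>p. f00 p * g01 p + f01 p * g00 p + (1 - fst p + snd p) * (f10 p * g11 p + f11 p * g10 p)) \<in> polys2 (2 * n + 2)"
    by (rule add[OF add[OF up[OF m[OF f(1) g(2)]] up[OF m[OF f(2) g(1)]]] l(2)[OF add[OF m[OF f(3) g(4)] m[OF f(4) g(3)]]]])
  show "(\<lambda>p. f00 p * g10 p + f10 p * g00 p + (1 + fst p + snd p) * (f01 p * g11 p + f11 p * g01 p)) \<in> polys2 (2 * n + 2)"
    by (rule add[OF add[OF up[OF m[OF f(1) g(3)]] up[OF m[OF f(3) g(1)]]] l(1)[OF add[OF m[OF f(2) g(4)] m[OF f(4) g(2)]]]])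
  show "(\<lambda>p. f00 p * g11 p + f11 p * g00 p + f01 p * g10 p + f10 p * g01 p) \<in> polys2 (2 * n + 2)"
    by (rule add[OF add[OF add[OF up[OF m[OF f(1) g(4)]] up[OF m[OF f(4) g(1)]]] up[OF m[OF f(2) g(3)]]] up[OF m[OF f(3) g(2)]]])
qed

text \<open>Different parities are orthogonal; each parity contributes an integral over \<open>Omega\<close> against a
  modified weight.\<close>

lemma parity_sum_mult_integral:
  assumes f: "f00 \<in> polys2 n" "f01 \<in> polys2 n" "f10 \<in> polys2 n" "f11 \<in> polys2 n"
    and g: "g00 \<in> polys2 n" "g01 \<in> polys2 n" "g10 \<in> polys2 n" "g11 \<in> polys2 n"
    and i: "has_bochner_integral (lebesgue_on Omega) (\<lambda>p. (f00 p * g00 p + (1 + fst p + snd p) * (f01 p * g01 p)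
        + (1 - fst p + snd p) * (f10 p * g10 p)
        + (1 + fst p + snd p) * (1 - fst p + snd p) * (f11 p * g11 p)) * W_weight w \<gamma> p) i"
  shows "has_bochner_integral (lebesgue_on square)
    (\<lambda>x. parity_sum f00 f01 f10 f11 x * parity_sum g00 g01 g10 g11 x * square_weight w \<gamma> x) i"
  using parity_sum_integral[OF parity_product_polys2[OF f g] i] by (simp only: parity_sum_mult)

text \<open>The integral of \<open>f\<^sup>2\<close> is the integral over \<open>Omega\<close> of a polynomial \<open>s\<close> that becomes, after
  substituting \<open>quad_map\<close>, the sum of the squares of the four terms of the decomposition of \<open>f\<close>.\<close>

lemma definite_square_weight: "definite_weight square (square_weight w \<gamma>)"
  unfolding definite_weight_def
proof (intro allI ballI)
  fix n f assume f: "f \<in> polys2 n"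
  obtain f00 f01 f10 f11 where p: "f00 \<in> polysZ (int n div 2)" "f01 \<in> polysZ ((int n - 1) div 2)"
     "f10 \<in> polysZ ((int n - 1) div 2)" "f11 \<in> polysZ (int n div 2 - 1)" and f_eq: "f = parity_sum f00 f01 f10 f11"
    using polys2_parity_decomposable[OF f] unfolding parity_decomposable_def by blast
  have q: "f00 \<in> polys2 n" "f01 \<in> polys2 n" "f10 \<in> polys2 n" "f11 \<in> polys2 n"
    using p[THEN polysZ_subset] by (auto elim!: polys2_mono)
  define s where "s = (\<lambda>p. f00 p * f00 p + (1 + fst p + snd p) * (f01 p * f01 p) + (1 - fst p + snd p) * (f10 p * f10 p)
        + (1 + fst p + snd p) * (1 - fst p + snd p) * (f11 p * f11 p))"
  have s: "s \<in> polys2 (2 * n + 2)" unfolding s_def by (rule parity_product_polys2(1)[OF q q])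
  obtain i where i: "has_bochner_integral (lebesgue_on Omega) (\<lambda>x. s x * W_weight w \<gamma> x) i"
    using Omega_integral[OF s] unfolding Omega_lebesgue_on_iff by blast
  have "has_bochner_integral (lebesgue_on square) (\<lambda>x. f x * f x * square_weight w \<gamma> x) i"
    unfolding f_eq by (rule parity_sum_mult_integral[OF q q i[unfolded s_def]])
  then have eq: "(LINT x|lebesgue_on square. f x * f x * square_weight w \<gamma> x) = i"
    by (rule has_bochner_integral_integral_eq)
  have nn: "0 \<le> s (sym_map x)" if "x \<in> square" for x
    using mod_factor_nonneg[OF that, of 0 1] mod_factor_nonneg[OF that, of 1 0] by (simp add: s_def)
  have 1: "integrable (lebesgue_on square) (\<lambda>x. f x * square_weight w \<gamma> x)"
    using parity_sum_integral[OF q Omega_integral[OF q(1), folded Omega_lebesgue_on_iff]]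
    unfolding f_eq by (simp add: has_bochner_integral_iff)
  have 2: "0 \<le> i" by (rule Omega_positive(1)[OF s nn i])
  have 3: "f = (\<lambda>x. 0)" if "i = 0"
  proof
    fix x
    define y where "y = quad_map x"
    have "s y = 0" using Omega_positive(2)[OF s nn i that] by simp
    then have "(f00 y)\<^sup>2 + ((fst x + snd x) * f01 y)\<^sup>2 + ((fst x - snd x) * f10 y)\<^sup>2
      + ((fst x + snd x) * (fst x - snd x) * f11 y)\<^sup>2 = 0"
      unfolding s_def y_def sum_square_quad_map diff_square_quad_map
      by (simp add: power_mult_distrib flip: power2_eq_square)
    then have z: "f00 y = 0" "(fst x + snd x) * f01 y = 0" "(fst x - snd x) * f10 y = 0"
      "(fst x + snd x) * (fst x - snd x) * f11 y = 0"
      by (simp_all only: add_nonneg_eq_0_iff zero_le_power2 add_nonneg_nonneg power_eq_0_iff)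
    have "(fst x)\<^sup>2 - (snd x)\<^sup>2 = (fst x + snd x) * (fst x - snd x)"
      by (simp add: power2_eq_square algebra_simps)
    then show "f x = 0"
      unfolding f_eq parity_sum_def y_def[symmetric] by (simp only: z add_0)
  qed
  show "integrable (lebesgue_on square) (\<lambda>x. f x * square_weight w \<gamma> x) \<and>
    0 \<le> (LINT x|lebesgue_on square. f x * f x * square_weight w \<gamma> x) \<and>
    ((LINT x|lebesgue_on square. f x * f x * square_weight w \<gamma> x) = 0 \<longrightarrow> f = (\<lambda>x. 0))"
    unfolding eq using 1 2 3 by blast
qed

section \<open>The kernel on the square\<close>

text \<open>The right-hand side of the kernel formula, arranged as the parity decomposition of a polynomial in
  the second argument.\<close>

definition assembled_kernel where
  "assembled_kernel n x = (let s = quad_map x in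
     parity_sum (\<lambda>t. reproducing_kernel Omega (W_weight w \<gamma>) (int n div 2) s t)
       (\<lambda>t. d_const 0 1 w \<gamma> * (fst x + snd x) *
         reproducing_kernel Omega (W_mod_weight 0 1 w \<gamma>) ((int n - 1) div 2) s t)
       (\<lambda>t. d_const 1 0 w \<gamma> * (fst x - snd x) *
         reproducing_kernel Omega (W_mod_weight 1 0 w \<gamma>) ((int n - 1) div 2) s t)
       (\<lambda>t. d_const 1 1 w \<gamma> * ((fst x)\<^sup>2 - (snd x)\<^sup>2) *
         reproducing_kernel Omega (W_mod_weight 1 1 w \<gamma>) (int n div 2 - 1) s t))"

theorem is_reproducing_kernel_assembled:
  "is_reproducing_kernel square (square_weight w \<gamma>) n (assembled_kernel n)"
proof -
  define a where "a x = fst x + snd x" for x :: "real \<times> real"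
  define b where "b x = fst x - snd x" for x :: "real \<times> real"
  define c where "c x = (fst x)\<^sup>2 - (snd x)\<^sup>2" for x :: "real \<times> real"
  define k where "k i j = reproducing_kernel Omega (W_mod_weight i j w \<gamma>)" for i j
  define d where "d i j = d_const i j w \<gamma>" for i j
  note kD = reproducing_kernelD[OF definite_W_mod_weight Omega_open Omega_nonempty subset_refl, folded k_def]
  have K: "assembled_kernel n x = parity_sum (\<lambda>t. k 0 0 (int n div 2) (quad_map x) t)
      (\<lambda>t. d 0 1 * a x * k 0 1 ((int n - 1) div 2) (quad_map x) t)
      (\<lambda>t. d 1 0 * b x * k 1 0 ((int n - 1) div 2) (quad_map x) t)
      (\<lambda>t. d 1 1 * c x * k 1 1 (int n div 2 - 1) (quad_map x) t)" for x
    by (simp add: assembled_kernel_def Let_def a_def b_def c_def d_def k_def W_mod_weight_0_0)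
  have mem: "(\<lambda>t. k 0 0 (int n div 2) s t) \<in> polysZ (int n div 2)"
    "(\<lambda>t. \<alpha> * k 0 1 ((int n - 1) div 2) s t) \<in> polysZ ((int n - 1) div 2)"
    "(\<lambda>t. \<alpha> * k 1 0 ((int n - 1) div 2) s t) \<in> polysZ ((int n - 1) div 2)"
    "(\<lambda>t. \<alpha> * k 1 1 (int n div 2 - 1) s t) \<in> polysZ (int n div 2 - 1)" for s \<alpha>
    by (intro polysZ_cmult kD)+
  show ?thesis unfolding is_reproducing_kernel_def
  proof (intro conjI allI ballI)
    fix x show "(\<lambda>y. assembled_kernel n x y) \<in> polys2 n"
      unfolding K by (intro parity_sum_polys2 mem)
  next
    fix y
    have "(\<lambda>x. assembled_kernel n x y) = parity_sum (\<lambda>s. k 0 0 (int n div 2) s (quad_map y))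
      (\<lambda>s. d 0 1 * a y * k 0 1 ((int n - 1) div 2) s (quad_map y))
      (\<lambda>s. d 1 0 * b y * k 1 0 ((int n - 1) div 2) s (quad_map y))
      (\<lambda>s. d 1 1 * c y * k 1 1 (int n div 2 - 1) s (quad_map y))"
      unfolding K parity_sum_def a_def[symmetric] b_def[symmetric] c_def[symmetric] by (simp add: mult_ac)
    also have "\<dots> \<in> polys2 n" by (intro parity_sum_polys2 polysZ_cmult kD)
    finally show "(\<lambda>x. assembled_kernel n x y) \<in> polys2 n" .
  next
    fix f x assume "f \<in> polys2 n"
    then obtain f00 f01 f10 f11 where p: "f00 \<in> polysZ (int n div 2)" "f01 \<in> polysZ ((int n - 1) div 2)"
        "f10 \<in> polysZ ((int n - 1) div 2)" "f11 \<in> polysZ (int n div 2 - 1)" and f_eq: "f = parity_sum f00 f01 f10 f11"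
      using polys2_parity_decomposable unfolding parity_decomposable_def by blast
    define s where "s = quad_map x"
    have up: "h \<in> polys2 n" if "h \<in> polysZ (int n div 2) \<or> h \<in> polysZ ((int n - 1) div 2) \<or> h \<in> polysZ (int n div 2 - 1)" for h
      using that by (auto dest!: polysZ_subset elim!: polys2_mono)
    have q: "f00 \<in> polys2 n" "f01 \<in> polys2 n" "f10 \<in> polys2 n" "f11 \<in> polys2 n"
      using p by (blast intro: up)+
    have r: "(\<lambda>t. k 0 0 (int n div 2) s t) \<in> polys2 n"
      "(\<lambda>t. d 0 1 * a x * k 0 1 ((int n - 1) div 2) s t) \<in> polys2 n"
      "(\<lambda>t. d 1 0 * b x * k 1 0 ((int n - 1) div 2) s t) \<in> polys2 n"
      "(\<lambda>t. d 1 1 * c x * k 1 1 (int n div 2 - 1) s t) \<in> polys2 n"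
      using mem by (blast intro: up)+
    define I where "I = (\<lambda>i j m g t. k i j m s t * g t * W_mod_weight i j w \<gamma> t)"
    have I: "has_bochner_integral (lebesgue_on Omega) (I i j m g) (g s)" if "g \<in> polysZ m" for i j m g
      unfolding I_def using kD(3)[OF that] .
    have "has_bochner_integral (lebesgue_on Omega) (\<lambda>t. I 0 0 (int n div 2) f00 t
        + a x * I 0 1 ((int n - 1) div 2) f01 t + b x * I 1 0 ((int n - 1) div 2) f10 t
        + c x * I 1 1 (int n div 2 - 1) f11 t)
      (f00 s + a x * f01 s + b x * f10 s + c x * f11 s)"
      by (intro has_bochner_integral_add has_bochner_integral_mult_right I p)
    also have "f00 s + a x * f01 s + b x * f10 s + c x * f11 s = f x"
      by (simp add: f_eq parity_sum_def s_def a_def b_def c_def)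
    also have "(\<lambda>t. I 0 0 (int n div 2) f00 t
        + a x * I 0 1 ((int n - 1) div 2) f01 t + b x * I 1 0 ((int n - 1) div 2) f10 t
        + c x * I 1 1 (int n div 2 - 1) f11 t) = (\<lambda>t. (k 0 0 (int n div 2) s t * f00 t
        + (1 + fst t + snd t) * (d 0 1 * a x * k 0 1 ((int n - 1) div 2) s t * f01 t)
        + (1 - fst t + snd t) * (d 1 0 * b x * k 1 0 ((int n - 1) div 2) s t * f10 t)
        + (1 + fst t + snd t) * (1 - fst t + snd t) * (d 1 1 * c x * k 1 1 (int n div 2 - 1) s t * f11 t))
        * W_weight w \<gamma> t)"
    proof
      fix t
      have W: "W_mod_weight 0 0 w \<gamma> t = W_weight w \<gamma> t"
        "W_mod_weight 0 1 w \<gamma> t = d 0 1 * (1 + fst t + snd t) * W_weight w \<gamma> t"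
        "W_mod_weight 1 0 w \<gamma> t = d 1 0 * (1 - fst t + snd t) * W_weight w \<gamma> t"
        "W_mod_weight 1 1 w \<gamma> t = d 1 1 * (1 - fst t + snd t) * (1 + fst t + snd t) * W_weight w \<gamma> t"
        by (simp_all add: W_mod_weight_0_0) (simp_all add: W_mod_weight_def d_def split_def)
      show "I 0 0 (int n div 2) f00 t
        + a x * I 0 1 ((int n - 1) div 2) f01 t + b x * I 1 0 ((int n - 1) div 2) f10 t
        + c x * I 1 1 (int n div 2 - 1) f11 t = (k 0 0 (int n div 2) s t * f00 t
        + (1 + fst t + snd t) * (d 0 1 * a x * k 0 1 ((int n - 1) div 2) s t * f01 t)
        + (1 - fst t + snd t) * (d 1 0 * b x * k 1 0 ((int n - 1) div 2) s t * f10 t)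
        + (1 + fst t + snd t) * (1 - fst t + snd t) * (d 1 1 * c x * k 1 1 (int n div 2 - 1) s t * f11 t))
        * W_weight w \<gamma> t"
        unfolding I_def W by (simp add: algebra_simps)
    qed
    finally show "has_bochner_integral (lebesgue_on square)
        (\<lambda>y. assembled_kernel n x y * f y * square_weight w \<gamma> y) (f x)"
      unfolding K s_def[symmetric] f_eq by (intro parity_sum_mult_integral[OF r q])
  qed
qed

lemma reproducing_kernel_square:
  "reproducing_kernel square (square_weight w \<gamma>) (int n) = assembled_kernel n"
proof (rule reproducing_kernel_eqI[OF definite_square_weight sector_open _ _ is_reproducing_kernel_assembled])
  have "(1/2, 0) \<in> sector" by (simp add: sector_def)
  then show "sector \<noteq> {}" by blast
  show "sector \<subseteq> square" by (auto simp: sector_def square_def)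
qed

end

theorem theorem4p9:
  fixes w :: "real \<Rightarrow> real" and \<gamma> :: real and n :: nat and x1 x2 y1 y2 :: real
  assumes w_measurable: "w \<in> borel_measurable (lebesgue_on {-1..1})"
    and w_nonneg: "\<And>x. x \<in> {-1..1} \<Longrightarrow> w x \<ge> 0"
    and gamma: "\<gamma> > -1"
    and finite_integral: "set_integrable lebesgue square (weight_integrand w \<gamma>)"
    and positive_integral: "(LINT p:square|lebesgue. weight_integrand w \<gamma> p) > 0"
    and x_in: "(x1, x2) \<in> square"
    and y_in: "(y1, y2) \<in> square"
  defines "s \<equiv> (2 * x1 * x2, x1\<^sup>2 + x2\<^sup>2 - 1)"
    and "t \<equiv> (2 * y1 * y2, y1\<^sup>2 + y2\<^sup>2 - 1)"
  shows "reproducing_kernel square (square_weight w \<gamma>) (int n) (x1, x2) (y1, y2) =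
      reproducing_kernel Omega (W_weight w \<gamma>) \<lfloor>real n / 2\<rfloor> s t
    + d_const 1 1 w \<gamma> * (x1\<^sup>2 - x2\<^sup>2) * (y1\<^sup>2 - y2\<^sup>2)
        * reproducing_kernel Omega (W_mod_weight 1 1 w \<gamma>) (\<lfloor>real n / 2\<rfloor> - 1) s t
    + d_const 0 1 w \<gamma> * (x1 + x2) * (y1 + y2)
        * reproducing_kernel Omega (W_mod_weight 0 1 w \<gamma>) \<lfloor>(real n - 1) / 2\<rfloor> s t
    + d_const 1 0 w \<gamma> * (x1 - x2) * (y1 - y2)
        * reproducing_kernel Omega (W_mod_weight 1 0 w \<gamma>) \<lfloor>(real n - 1) / 2\<rfloor> s t"
proof -
  interpret admissible_weight w \<gamma>
    using w_nonneg finite_integral positive_integral by unfold_locales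
  have "\<lfloor>real n / 2\<rfloor> = int n div 2" "\<lfloor>(real n - 1) / 2\<rfloor> = (int n - 1) div 2"
    using floor_divide_of_int_eq[of "int n" 2] floor_divide_of_int_eq[of "int n - 1" 2] by simp_all
  moreover have "quad_map (x1, x2) = s" "quad_map (y1, y2) = t"
    by (simp_all add: quad_map_def s_def t_def)
  ultimately show ?thesis
    by (simp add: reproducing_kernel_square assembled_kernel_def parity_sum_def Let_def mult_ac)
qed

end
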